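(* Let $Q$ be a continuous domain, $H\subseteq Q$ and $\alpha<\omega_1$ be an ordinal. \begin{enumerate} \item The following conditions are equivalent. \begin{enumerate} \item[$(i)$] $H$ is Wadge hard for $\mathbf{D}_\alpha(P)$ for every continuous domain $P$. \item[$(ii)$] $H$ is Wadge hard for $\mathbf{D}_\alpha(\mathcal{P}(\mathbb{N}))$. \item[$(iii)$] $H$ is Wadge hard for $\mathbf{D}_\alpha(P)$ for some continuous domain $P$ admitting a strictly decreasing chain of length $\alpha+1$. \item[$(iv)$] There exists a decreasing $H$-alternating chain in $Q$ of length $\alpha+1$. \end{enumerate} \item Suppose $Q$ is an $\omega$-continuous domain and fix some presentation $(q_n)_{n\in\mathbb{N}}$ of $Q$. If $\alpha<\omega_1^{CK}$ the following conditions are equivalent. \begin{enumerate} \item[$(i_e)$] $H$ is Wadge hard for $\mathbf{D}_\alpha(P)$ and effectively Wadge hard for the effective class $\mathrm{D}_\alpha(P)$ for every effective $\omega$-continuous domain $P$. \item[$(ii_e)$] $H$ is effectively Wadge hard for $\mathrm{D}_\alpha(\mathcal{P}(\mathbb{N}))$. \item[$(iii_e)$] $H$ is effectively Wadge hard for $\mathrm{D}_\alpha(P)$ for some effective $\omega$-algebraic domain $P$ admitting a computable strictly decreasing chain of length $\alpha+1$. \item[$(iv_e)$] There exists an effective decreasing $H$-alternating chain in $Q$ of length $\alpha+1$. \end{enumerate} \end{enumerate}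
   Context: $\mathcal{P}(\mathbb{N})$ is the set of subsets of $\mathbb{N}$ ordered by inclusion with the Scott topology (an $\omega$-algebraic domain). $\omega_1^{CK}$ is the least non-computable ordinal. For ordinals, $\beta\sim\alpha$ means $\beta,\alpha$ have the same parity. $\mathbf{D}_\alpha(P)$ is the class of sets $\bigcup\{A_\beta\setminus\bigcup_{\gamma<\beta}A_\gamma \mid \beta<\alpha,\ \beta\not\sim\alpha\}$ with $(A_\beta)_{\beta<\alpha}$ open subsets of $P$; $\mathrm{D}_\alpha(P)$ is its effective version relative to a fixed presentation of the topology. A set $H\subseteq Q$ is Wadge hard for a class $\mathcal{C}$ of subsets of $P$ if every $X\in\mathcal{C}$ equals $f^{-1}(H)$ for some continuous $f:P\to Q$; effectively Wadge hard if the $f$ can be taken effective. An $(\alpha+1)$-sequence $(x_\beta)_{\beta\leq\alpha}$ in $Q$ is a decreasing $H$-alternating chain if $x_\beta\sqsupset x_\delta$ for all $\beta<\delta\leq\alpha$ and $x_\beta\in H$ iff $\beta\not\sim\alpha$. A presentation of an $\omega$-continuous domain is an enumeration $(p_n)_{n\in\mathbb{N}}$ of a basis; it is effective if $\{(i,j)\mid p_i\ll p_j\}$ is computably enumerable ($\ll$ the way-below relation). For $\alpha<\omega_1^{CK}$, a sequence $(x_\beta)_{\beta\leq\alpha}$ is effective (resp. computable) if there is a computable relation $R\subseteq\mathbb{N}^2$ isomorphic via some $\rho:\mathbb{N}\to\alpha+1$ to the order of $\alpha+1$ such that $\{(n,i)\mid p_i\ll x_{\rho(n)}\}$ is computably enumerable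 (resp. computable). Convention for the effective part: effective reductions $P\to Q$ are relative to the presentations $(\{y\mid p_n\ll y\})_{n\in\mathbb{N}}$ and $(\{y\mid q_n\ll y\})_{n\in\mathbb{N}}$ of the Scott topologies on $P,Q$ associated to presentations $(p_n)_{n\in\mathbb{N}}$ and $(q_n)_{n\in\mathbb{N}}$ of the $\omega$-continuous domains $P,Q$; a continuous map $f$ is effective relative to topology presentations $(U_n)$, $(V_n)$ if $\{(i,j)\mid f(U_i)\subseteq V_j\}$ is computably enumerable.
   Formalization: f is effective when some c.e. set of pairs with f(U_i) ⊆ V_j recovers all preimages of V_j (with all pairs, (iv_e)⇒(i_e) fails); effective D_α(P) is taken for some fixed computable copy of α+1, uniform in P, shared with the chain in (iii_e). *)

theory Defs
  imports "HOL-Analysis.Abstract_Topology" "HOL-Library.Countable_Set" "HOL-Library.Nat_Bijection"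
begin

section \<open>Continuous domains\<close>

text \<open>A partially ordered set is a relation \<open>P\<close> with carrier \<^term>\<open>Field P\<close>;
  \<open>(x, y) \<in> P\<close> is \<open>x \<sqsubseteq> y\<close>. Domains are not required to have a least element.\<close>

definition directed :: "'a rel \<Rightarrow> 'a set \<Rightarrow> bool" where
  "directed P D \<longleftrightarrow>
     D \<subseteq> Field P \<and> D \<noteq> {} \<and> (\<forall>x\<in>D. \<forall>y\<in>D. \<exists>z\<in>D. (x, z) \<in> P \<and> (y, z) \<in> P)"

definition is_sup :: "'a rel \<Rightarrow> 'a set \<Rightarrow> 'a \<Rightarrow> bool" where
  "is_sup P D s \<longleftrightarrow>
     s \<in> Field P \<and> (\<forall>x\<in>D. (x, s) \<in> P) \<and>
     (\<forall>u\<in>Field P. (\<forall>x\<in>D. (x, u) \<in> P) \<longrightarrow> (s, u) \<in> P)"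

definition dcpo :: "'a rel \<Rightarrow> bool" where
  "dcpo P \<longleftrightarrow> Partial_order P \<and> (\<forall>D. directed P D \<longrightarrow> (\<exists>s. is_sup P D s))"

definition way_below :: "'a rel \<Rightarrow> 'a \<Rightarrow> 'a \<Rightarrow> bool" where
  "way_below P x y \<longleftrightarrow>
     x \<in> Field P \<and> y \<in> Field P \<and>
     (\<forall>D s. directed P D \<and> is_sup P D s \<and> (y, s) \<in> P \<longrightarrow> (\<exists>d\<in>D. (x, d) \<in> P))"

definition domain_basis :: "'a rel \<Rightarrow> 'a set \<Rightarrow> bool" where
  "domain_basis P B \<longleftrightarrow>
     B \<subseteq> Field P \<and>
     (\<forall>x\<in>Field P. directed P {b \<in> B. way_below P b x} \<and> is_sup P {b \<in> B. way_below P b x} x)"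

definition continuous_domain :: "'a rel \<Rightarrow> bool" where
  "continuous_domain P \<longleftrightarrow> dcpo P \<and> domain_basis P (Field P)"

definition algebraic_domain :: "'a rel \<Rightarrow> bool" where
  "algebraic_domain P \<longleftrightarrow> dcpo P \<and> domain_basis P {x. way_below P x x}"

text \<open>\<open>presentation P p\<close> makes \<open>P\<close> an \<open>\<omega>\<close>-continuous domain, and an \<open>\<omega>\<close>-algebraic one
  if moreover \<^term>\<open>algebraic_domain P\<close>.\<close>

definition presentation :: "'a rel \<Rightarrow> (nat \<Rightarrow> 'a) \<Rightarrow> bool" where
  "presentation P p \<longleftrightarrow> continuous_domain P \<and> domain_basis P (range p)"

definition scott_open :: "'a rel \<Rightarrow> 'a set \<Rightarrow> bool" where
  "scott_open P U \<longleftrightarrow>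
     U \<subseteq> Field P \<and> (\<forall>x y. x \<in> U \<and> (x, y) \<in> P \<longrightarrow> y \<in> U) \<and>
     (\<forall>D s. directed P D \<and> is_sup P D s \<and> s \<in> U \<longrightarrow> D \<inter> U \<noteq> {})"

definition scott :: "'a rel \<Rightarrow> 'a topology" where
  "scott P = topology (scott_open P)"

definition basic_open :: "'a rel \<Rightarrow> (nat \<Rightarrow> 'a) \<Rightarrow> nat \<Rightarrow> 'a set" where
  "basic_open P p n = {y. way_below P (p n) y}"

text \<open>The domain of sets of natural numbers, presented by its finite elements
  in their canonical indexing \<^const>\<open>set_decode\<close>. Quantification over all domains is
  rendered by relations on \<^typ>\<open>'p + nat set\<close> with \<open>'p\<close> arbitrary: the left summand makes
  room for domains of any size, the right one for a copy of \<open>pow_nat\<close>.\<close>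

definition pow_nat :: "nat set rel" where
  "pow_nat = {(A, B). A \<subseteq> B}"

section \<open>Countable ordinals\<close>

text \<open>The ordinal \<open>\<alpha>\<close> is an element of a well-ordered type and stands for the order type of
  \<^term>\<open>{..<\<alpha>}\<close>; thus \<open>\<alpha> + 1\<close> is the order type of \<^term>\<open>{..\<alpha>}\<close>, and \<open>\<alpha> < \<omega>\<^sub>1\<close> is
  countability of \<^term>\<open>{..<\<alpha>}\<close>. An element is even if it has the form \<open>\<lambda> + 2 n\<close> with
  \<open>\<lambda>\<close> zero or limit.\<close>

definition imm_succ :: "'i::wellorder \<Rightarrow> 'i \<Rightarrow> bool" where
  "imm_succ \<gamma> \<beta> \<longleftrightarrow> \<gamma> < \<beta> \<and> \<not> (\<exists>\<delta>. \<gamma> < \<delta> \<and> \<delta> < \<beta>)"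

inductive even_ord :: "'i::wellorder \<Rightarrow> bool" where
  zero_or_limit: "(\<And>\<gamma>. \<not> imm_succ \<gamma> \<beta>) \<Longrightarrow> even_ord \<beta>"
| add_two: "even_ord \<gamma> \<Longrightarrow> imm_succ \<gamma> \<delta> \<Longrightarrow> imm_succ \<delta> \<beta> \<Longrightarrow> even_ord \<beta>"

definition same_parity :: "'i::wellorder \<Rightarrow> 'i \<Rightarrow> bool" where
  "same_parity \<beta> \<alpha> \<longleftrightarrow> (even_ord \<beta> \<longleftrightarrow> even_ord \<alpha>)"

section \<open>Difference classes, Wadge hardness and chains\<close>

definition diff_set :: "'i::wellorder \<Rightarrow> ('i \<Rightarrow> 'a set) \<Rightarrow> 'a set" where
  "diff_set \<alpha> A = (\<Union>\<beta>\<in>{\<beta>. \<beta> < \<alpha> \<and> \<not> same_parity \<beta> \<alpha>}. A \<beta> - (\<Union>\<gamma>\<in>{..<\<beta>}. A \<gamma>))"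

definition diff_class :: "'i::wellorder \<Rightarrow> 'a rel \<Rightarrow> 'a set set" where
  "diff_class \<alpha> P = {diff_set \<alpha> A | A. \<forall>\<beta><\<alpha>. openin (scott P) (A \<beta>)}"

definition wadge_hard :: "'p rel \<Rightarrow> 'q rel \<Rightarrow> 'q set \<Rightarrow> 'p set set \<Rightarrow> bool" where
  "wadge_hard P Q H \<C> \<longleftrightarrow>
     (\<forall>X\<in>\<C>. \<exists>f. continuous_map (scott P) (scott Q) f \<and> X = {x \<in> Field P. f x \<in> H})"

definition decreasing_chain :: "'a rel \<Rightarrow> 'i::wellorder \<Rightarrow> ('i \<Rightarrow> 'a) \<Rightarrow> bool" where
  "decreasing_chain P \<alpha> x \<longleftrightarrow>
     (\<forall>\<beta>\<le>\<alpha>. x \<beta> \<in> Field P) \<and>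
     (\<forall>\<beta> \<delta>. \<beta> < \<delta> \<and> \<delta> \<le> \<alpha> \<longrightarrow> (x \<delta>, x \<beta>) \<in> P \<and> x \<delta> \<noteq> x \<beta>)"

definition alternating_chain :: "'a rel \<Rightarrow> 'a set \<Rightarrow> 'i::wellorder \<Rightarrow> ('i \<Rightarrow> 'a) \<Rightarrow> bool" where
  "alternating_chain P H \<alpha> x \<longleftrightarrow>
     decreasing_chain P \<alpha> x \<and> (\<forall>\<beta>\<le>\<alpha>. x \<beta> \<in> H \<longleftrightarrow> \<not> same_parity \<beta> \<alpha>)"

section \<open>Computability\<close>

text \<open>Total recursive functions of arity \<open>n\<close>, acting on lists of length \<open>n\<close> (values on other
  lists are irrelevant, by \<open>ext\<close>). Minimization is only applied to functions that
  have a zero for all parameters, so that only total functions arise.\<close>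

inductive recursive :: "nat \<Rightarrow> (nat list \<Rightarrow> nat) \<Rightarrow> bool" where
  zero: "recursive n (\<lambda>xs. 0)"
| suc: "recursive 1 (\<lambda>xs. Suc (xs ! 0))"
| proj: "i < n \<Longrightarrow> recursive n (\<lambda>xs. xs ! i)"
| comp: "recursive (length gs) f \<Longrightarrow> (\<And>g. g \<in> set gs \<Longrightarrow> recursive n g) \<Longrightarrow>
    recursive n (\<lambda>xs. f (map (\<lambda>g. g xs) gs))"
| prim_rec: "recursive n f \<Longrightarrow> recursive (Suc (Suc n)) g \<Longrightarrow>
    recursive (Suc n) (\<lambda>xs. rec_nat (f (tl xs)) (\<lambda>k r. g (k # r # tl xs)) (hd xs))"
| minim: "recursive (Suc n) f \<Longrightarrow> (\<And>xs. length xs = n \<Longrightarrow> \<exists>k. f (k # xs) = 0) \<Longrightarrow>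
    recursive n (\<lambda>xs. LEAST k. f (k # xs) = 0)"
| ext: "recursive n f \<Longrightarrow> (\<And>xs. length xs = n \<Longrightarrow> f xs = g xs) \<Longrightarrow> recursive n g"

definition computable_rel :: "nat rel \<Rightarrow> bool" where
  "computable_rel S \<longleftrightarrow> recursive 2 (\<lambda>xs. if (xs ! 0, xs ! 1) \<in> S then 1 else 0)"

definition ce_rel :: "nat rel \<Rightarrow> bool" where
  "ce_rel S \<longleftrightarrow>
     S = {} \<or> (\<exists>f g. recursive 1 f \<and> recursive 1 g \<and> S = range (\<lambda>k. (f [k], g [k])))"

definition effective_presentation :: "'a rel \<Rightarrow> (nat \<Rightarrow> 'a) \<Rightarrow> bool" where
  "effective_presentation P p \<longleftrightarrow> presentation P p \<and> ce_rel {(i, j). way_below P (p i) (p j)}"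

text \<open>A computable copy of a set \<open>S\<close> of ordinals: a computable (reflexive) order \<open>R\<close> on a set
  \<^term>\<open>Field R\<close> of natural numbers, isomorphic to \<open>S\<close> via \<open>\<rho>\<close>. The domain of \<open>\<rho>\<close> may be
  a proper subset of \<open>\<nat>\<close>, as is necessary when \<open>S\<close> is finite.\<close>

definition computable_copy :: "nat rel \<Rightarrow> (nat \<Rightarrow> 'i::wellorder) \<Rightarrow> 'i set \<Rightarrow> bool" where
  "computable_copy R \<rho> S \<longleftrightarrow>
     computable_rel R \<and> bij_betw \<rho> (Field R) S \<and>
     (\<forall>m\<in>Field R. \<forall>n\<in>Field R. (m, n) \<in> R \<longleftrightarrow> \<rho> m \<le> \<rho> n)"

text \<open>\<open>\<alpha>\<close> is less than the least non-computable ordinal.\<close>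

definition below_omega1_CK :: "'i::wellorder \<Rightarrow> bool" where
  "below_omega1_CK \<alpha> \<longleftrightarrow> (\<forall>\<beta>\<le>\<alpha>. \<exists>R \<rho>. computable_copy R \<rho> {..<\<beta>})"

definition chain_rel ::
  "'a rel \<Rightarrow> (nat \<Rightarrow> 'a) \<Rightarrow> nat rel \<Rightarrow> (nat \<Rightarrow> 'i) \<Rightarrow> ('i \<Rightarrow> 'a) \<Rightarrow> nat rel" where
  "chain_rel P p R \<rho> x = {(n, i). n \<in> Field R \<and> way_below P (p i) (x (\<rho> n))}"

definition effective_seq ::
  "'a rel \<Rightarrow> (nat \<Rightarrow> 'a) \<Rightarrow> 'i::wellorder \<Rightarrow> ('i \<Rightarrow> 'a) \<Rightarrow> bool" where
  "effective_seq P p \<alpha> x \<longleftrightarrow>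
     (\<exists>R \<rho>. computable_copy R \<rho> {..\<alpha>} \<and> ce_rel (chain_rel P p R \<rho> x))"

text \<open>The effective difference class, for a topology presented by \<open>U\<close>. It consists of the
  differences of uniformly c.e. unions of the \<open>U\<^sub>i\<close>. It depends, as the levels of the Ershov
  hierarchy do, on how \<open>\<alpha>\<close> is given effectively, namely by a computable copy \<open>R\<close>, \<open>\<rho>\<close> of
  \<open>\<alpha> + 1\<close>.\<close>

definition eff_diff_class ::
  "nat rel \<Rightarrow> (nat \<Rightarrow> 'i) \<Rightarrow> 'i::wellorder \<Rightarrow> (nat \<Rightarrow> 'a set) \<Rightarrow> 'a set set" where
  "eff_diff_class R \<rho> \<alpha> U = {diff_set \<alpha> A | A.
     \<exists>W. ce_rel W \<and> (\<forall>n\<in>Field R. \<rho> n < \<alpha> \<longrightarrow> A (\<rho> n) = (\<Union>i\<in>{i. (n, i) \<in> W}. U i))}"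

text \<open>Effective continuity is witnessed by a c.e. set of pairs \<open>(i, j)\<close> with
  \<open>f(U\<^sub>i) \<subseteq> V\<^sub>j\<close> that suffices to recover every preimage of a \<open>V\<^sub>j\<close>. When \<open>U\<close> comes from an
  effective enumeration of compact elements, this is the same as the set of all such pairs being
  c.e. (\<open>effective_map_compact_iff\<close> below). It is not over other bases:
  over the unit interval, \<open>(a, 1] \<subseteq> (r, 1]\<close> says \<open>r \<le> a\<close>, which is not
  semi-decidable when \<open>r\<close> is approximated from above.\<close>

definition effective_map ::
  "'p rel \<Rightarrow> (nat \<Rightarrow> 'p set) \<Rightarrow> 'q rel \<Rightarrow> (nat \<Rightarrow> 'q set) \<Rightarrow> ('p \<Rightarrow> 'q) \<Rightarrow> bool" where
  "effective_map P U Q V f \<longleftrightarrow>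
     continuous_map (scott P) (scott Q) f \<and>
     (\<exists>W. ce_rel W \<and> W \<subseteq> {(i, j). f ` U i \<subseteq> V j} \<and>
        (\<forall>j. {x \<in> Field P. f x \<in> V j} = (\<Union>i\<in>{i. (i, j) \<in> W}. U i)))"

definition eff_wadge_hard ::
  "'p rel \<Rightarrow> (nat \<Rightarrow> 'p) \<Rightarrow> 'q rel \<Rightarrow> (nat \<Rightarrow> 'q) \<Rightarrow> 'q set \<Rightarrow> 'p set set \<Rightarrow> bool" where
  "eff_wadge_hard P p Q q H \<C> \<longleftrightarrow>
     (\<forall>X\<in>\<C>. \<exists>f. effective_map P (basic_open P p) Q (basic_open Q q) f \<and>
                X = {x \<in> Field P. f x \<in> H})"

section \<open>Auxiliary facts\<close>

lemma istopology_scott_open: "istopology (scott_open P)"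
proof -
  have "scott_open P (S \<inter> T)" if S: "scott_open P S" and T: "scott_open P T" for S T
    unfolding scott_open_def
  proof (intro conjI allI impI)
    show "S \<inter> T \<subseteq> Field P" using S by (auto simp: scott_open_def)
    show "y \<in> S \<inter> T" if "x \<in> S \<inter> T \<and> (x, y) \<in> P" for x y
      using that S T unfolding scott_open_def by blast
    fix D s assume D: "directed P D \<and> is_sup P D s \<and> s \<in> S \<inter> T"
    have "D \<inter> S \<noteq> {}" "D \<inter> T \<noteq> {}"
      using S T D unfolding scott_open_def by blast+
    then obtain x y where xy: "x \<in> D" "x \<in> S" "y \<in> D" "y \<in> T" by blast
    then obtain z where "z \<in> D" "(x, z) \<in> P" "(y, z) \<in> P"
      using D unfolding directed_def by blast
    then show "D \<inter> (S \<inter> T) \<noteq> {}"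
      using S T xy unfolding scott_open_def by blast
  qed
  moreover have "scott_open P (\<Union>\<K>)" if K: "\<forall>K\<in>\<K>. scott_open P K" for \<K>
    unfolding scott_open_def
  proof (intro conjI allI impI)
    show "\<Union>\<K> \<subseteq> Field P" using K by (auto simp: scott_open_def)
    show "y \<in> \<Union>\<K>" if "x \<in> \<Union>\<K> \<and> (x, y) \<in> P" for x y
      using that K unfolding scott_open_def by blast
    fix D s assume D: "directed P D \<and> is_sup P D s \<and> s \<in> \<Union>\<K>"
    then obtain K where "K \<in> \<K>" "s \<in> K" by blast
    then have "D \<inter> K \<noteq> {}" using K D unfolding scott_open_def by blast
    then show "D \<inter> \<Union>\<K> \<noteq> {}" using \<open>K \<in> \<K>\<close> by blast
  qed
  ultimately show ?thesis unfolding istopology_def by blast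
qed

lemma openin_scott: "openin (scott P) U \<longleftrightarrow> scott_open P U"
  by (simp add: scott_def istopology_scott_open topology_inverse')

lemma topspace_scott: "topspace (scott P) = Field P"
proof -
  have "scott_open P (Field P)"
    unfolding scott_open_def directed_def by (auto simp: Field_def)
  then show ?thesis
    unfolding topspace_def openin_scott by (auto simp: scott_open_def)
qed

lemma recursive_cong:
  assumes "recursive m f" "m = n" "\<And>xs. length xs = n \<Longrightarrow> f xs = g xs"
  shows "recursive n g"
  using ext[of n f g] assms by simp

lemma recursive_comp1:
  assumes "recursive 1 f" "recursive n g"
  shows "recursive n (\<lambda>xs. f [g xs])"
  using comp[of "[g]" f n] assms by simp

lemma recursive_comp2:
  assumes "recursive 2 f" "recursive n g" "recursive n h"
  shows "recursive n (\<lambda>xs. f [g xs, h xs])"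
  using comp[of "[g, h]" f n] assms by (auto simp: numeral_2_eq_2)

lemma recursive_Suc: "recursive n f \<Longrightarrow> recursive n (\<lambda>xs. Suc (f xs))"
  using recursive_comp1[OF suc, of n f] by simp

lemma recursive_const: "recursive n (\<lambda>xs. c)"
  by (induction c) (auto intro: recursive.zero recursive_Suc)

lemma rec_nat_add: "rec_nat b (\<lambda>k. Suc) a = a + (b::nat)"
  by (induction a) auto

lemma rec_nat_mult: "rec_nat 0 (\<lambda>k r. r + b) a = a * (b::nat)"
  by (induction a) auto

lemma rec_nat_pred: "rec_nat 0 (\<lambda>k r. k) a = a - (1::nat)"
  by (cases a) auto

lemma rec_nat_diff: "rec_nat b (\<lambda>k r. r - 1) a = b - (a::nat)"
  by (induction a) auto

lemma length2E: "length xs = 2 \<Longrightarrow> (\<And>a b. xs = [a, b] \<Longrightarrow> R) \<Longrightarrow> R"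
  by (auto simp: numeral_2_eq_2 length_Suc_conv)

lemma recursive_add:
  assumes "recursive n f" "recursive n g" shows "recursive n (\<lambda>xs. f xs + g xs)"
proof -
  have "recursive (Suc 1) (\<lambda>xs. rec_nat ((\<lambda>ys. ys ! 0) (tl xs))
      (\<lambda>k r. (\<lambda>ys. Suc (ys ! 1)) (k # r # tl xs)) (hd xs))"
    by (rule prim_rec) (auto intro!: recursive_Suc proj)
  then have "recursive 2 (\<lambda>xs. xs ! 0 + xs ! 1)"
    by (rule recursive_cong) (auto elim!: length2E simp: rec_nat_add)
  from recursive_comp2[OF this assms] show ?thesis by simp
qed

lemma recursive_mult:
  assumes "recursive n f" "recursive n g" shows "recursive n (\<lambda>xs. f xs * g xs)"
proof -
  have "recursive (Suc 1) (\<lambda>xs. rec_nat ((\<lambda>ys. 0) (tl xs))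
      (\<lambda>k r. (\<lambda>ys. ys ! 1 + ys ! 2) (k # r # tl xs)) (hd xs))"
    by (rule prim_rec) (auto intro!: recursive_add proj zero)
  then have "recursive 2 (\<lambda>xs. xs ! 0 * xs ! 1)"
    by (rule recursive_cong) (auto elim!: length2E simp: rec_nat_mult)
  from recursive_comp2[OF this assms] show ?thesis by simp
qed

lemma recursive_pred:
  assumes "recursive n f" shows "recursive n (\<lambda>xs. f xs - 1)"
proof -
  have "recursive (Suc 0) (\<lambda>xs. rec_nat ((\<lambda>ys. 0) (tl xs))
      (\<lambda>k r. (\<lambda>ys. ys ! 0) (k # r # tl xs)) (hd xs))"
    by (rule prim_rec) (auto intro!: proj zero)
  then have "recursive 1 (\<lambda>xs. xs ! 0 - 1)"
    by (rule recursive_cong) (auto simp: length_Suc_conv rec_nat_pred[simplified])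
  from recursive_comp1[OF this assms] show ?thesis by simp
qed

lemma recursive_diff:
  assumes "recursive n f" "recursive n g" shows "recursive n (\<lambda>xs. f xs - g xs)"
proof -
  have "recursive (Suc 1) (\<lambda>xs. rec_nat ((\<lambda>ys. ys ! 0) (tl xs))
      (\<lambda>k r. (\<lambda>ys. ys ! 1 - 1) (k # r # tl xs)) (hd xs))"
    by (rule prim_rec) (auto intro!: recursive_pred[simplified] proj)
  then have "recursive 2 (\<lambda>xs. xs ! 1 - xs ! 0)"
    by (rule recursive_cong) (auto elim!: length2E simp: rec_nat_diff[simplified])
  from recursive_comp2[OF this assms(2,1)] show ?thesis by simp
qed

lemma recursive_if_eq:
  assumes "recursive n f" "recursive n g" "recursive n h" "recursive n k"
  shows "recursive n (\<lambda>xs. if f xs = g xs then h xs else k xs)"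
proof -
  let ?e = "\<lambda>xs. 1 - ((f xs - g xs) + (g xs - f xs))"
  have "recursive n (\<lambda>xs. ?e xs * h xs + (1 - ?e xs) * k xs)"
    by (intro recursive_add recursive_mult recursive_diff recursive_const assms)
  then show ?thesis by (rule ext) auto
qed

text \<open>A recursive surjection \<open>n = s\<^sup>2 + a \<mapsto> (a, s - a)\<close>, where \<open>s\<close> is the integer square root.\<close>

lemma recursive_pair_enum:
  "\<exists>g h. recursive 1 g \<and> recursive 1 h \<and> (\<forall>a b. \<exists>k. g [k] = a \<and> h [k] = b)"
proof -
  define F :: "nat list \<Rightarrow> nat" where "F ys = Suc (ys ! 1) - Suc (ys ! 0) * Suc (ys ! 0)" for ys
  define r where "r xs = (LEAST k. F (k # xs) = 0)" for xs :: "nat list"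
  define g where "g xs = xs ! 0 - r xs * r xs" for xs
  define h where "h xs = r xs - g xs" for xs
  have "recursive (Suc 1) F"
    unfolding F_def by (rule recursive_diff recursive_mult recursive_Suc proj | simp)+
  moreover have "\<exists>k. F (k # xs) = 0" for xs
    by (rule exI[of _ "xs ! 0"]) (simp add: F_def)
  ultimately have r: "recursive 1 r" unfolding r_def by (rule minim)
  have g: "recursive 1 g" unfolding g_def by (rule recursive_diff recursive_mult r proj zero_less_one)+
  have h: "recursive 1 h" unfolding h_def by (rule recursive_diff r g)+
  have rt: "r [(a + b) * (a + b) + a] = a + b" for a b
    unfolding r_def
  proof (rule Least_equality)
    show "F ((a + b) # [(a + b) * (a + b) + a]) = 0"
      by (simp add: F_def)
    fix y assume "F (y # [(a + b) * (a + b) + a]) = 0"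
    then have *: "(a + b) * (a + b) + a < Suc y * Suc y" by (simp add: F_def)
    show "a + b \<le> y"
    proof (rule ccontr)
      assume "\<not> a + b \<le> y"
      then have "Suc y * Suc y \<le> (a + b) * (a + b)" by (intro mult_le_mono) auto
      with * show False by linarith
    qed
  qed
  have "g [(a + b) * (a + b) + a] = a \<and> h [(a + b) * (a + b) + a] = b" for a b
    unfolding h_def g_def rt by simp
  then show ?thesis using g h by blast
qed

lemma ce_rel_compose:
  assumes W: "ce_rel W" and B: "ce_rel B"
  shows "ce_rel {(i, j). \<exists>k. (k, j) \<in> W \<and> (k, i) \<in> B}" (is "ce_rel ?S")
proof (cases "?S = {}")
  case True
  then show ?thesis unfolding ce_rel_def by (intro disjI1)
next
  case False
  then obtain i0 j0 where S0: "(i0, j0) \<in> ?S" by auto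
  then have ne: "W \<noteq> {}" "B \<noteq> {}" by auto
  obtain a b where ab: "recursive 1 a" "recursive 1 b"
    and W': "W = range (\<lambda>k. (a [k], b [k]))"
    using W ne(1) unfolding ce_rel_def by blast
  obtain c d where cd: "recursive 1 c" "recursive 1 d"
    and B': "B = range (\<lambda>k. (c [k], d [k]))"
    using B ne(2) unfolding ce_rel_def by blast
  obtain g h where gh: "recursive 1 g" "recursive 1 h" "\<And>s t. \<exists>k. g [k] = s \<and> h [k] = t"
    using recursive_pair_enum by blast
  let ?F = "\<lambda>xs. if a [g xs] = c [h xs] then d [h xs] else i0"
  let ?G = "\<lambda>xs. if a [g xs] = c [h xs] then b [g xs] else j0"
  note comps = recursive_comp1[OF ab(1) gh(1)] recursive_comp1[OF ab(2) gh(1)]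
    recursive_comp1[OF cd(1) gh(2)] recursive_comp1[OF cd(2) gh(2)]
  have "recursive 1 ?F" "recursive 1 ?G"
    by (rule recursive_if_eq[OF comps(1,3,4) recursive_const],
        rule recursive_if_eq[OF comps(1,3,2) recursive_const])
  moreover have "?S = range (\<lambda>k. (?F [k], ?G [k]))"
  proof
    show "range (\<lambda>k. (?F [k], ?G [k])) \<subseteq> ?S"
    proof
      fix z assume "z \<in> range (\<lambda>k. (?F [k], ?G [k]))"
      then obtain k where z: "z = (?F [k], ?G [k])" by blast
      show "z \<in> ?S"
      proof (cases "a [g [k]] = c [h [k]]")
        case True
        have "(a [g [k]], b [g [k]]) \<in> W" unfolding W' by (rule rangeI)
        moreover have "(c [h [k]], d [h [k]]) \<in> B" unfolding B' by (rule rangeI)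
        ultimately show ?thesis using True z by auto
      next
        case False
        then show ?thesis using S0 z by simp
      qed
    qed
    show "?S \<subseteq> range (\<lambda>k. (?F [k], ?G [k]))"
    proof clarify
      fix i j k assume "(k, j) \<in> W" "(k, i) \<in> B"
      then obtain s t where st: "k = a [s]" "j = b [s]" "k = c [t]" "i = d [t]"
        unfolding W' B' by blast
      obtain n where "g [n] = s" "h [n] = t" using gh(3) by blast
      then show "(i, j) \<in> range (\<lambda>k. (?F [k], ?G [k]))"
        using st by (intro image_eqI[of _ _ n]) auto
    qed
  qed
  ultimately show ?thesis unfolding ce_rel_def by (intro disjI2 exI conjI)
qed

lemma way_below_imp_le:
  assumes "Partial_order P" "way_below P x y" shows "(x, y) \<in> P"
proof -
  have y: "y \<in> Field P" "(y, y) \<in> P"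
    using assms by (auto simp: way_below_def partial_order_on_def preorder_on_def refl_on_def)
  then have "directed P {y}" "is_sup P {y} y"
    by (auto simp: directed_def is_sup_def)
  then show ?thesis using assms y unfolding way_below_def by blast
qed

lemma way_below_trans:
  assumes po: "Partial_order P" and xy: "way_below P x y" and yz: "way_below P y z"
  shows "way_below P x z"
  unfolding way_below_def
proof (intro conjI allI impI)
  show "x \<in> Field P" "z \<in> Field P" using xy yz by (auto simp: way_below_def)
  fix D s assume "directed P D \<and> is_sup P D s \<and> (z, s) \<in> P"
  then obtain d where d: "d \<in> D" "(y, d) \<in> P" using yz unfolding way_below_def by blast
  moreover have "trans P" using po by (auto simp: partial_order_on_def preorder_on_def)
  ultimately show "\<exists>d\<in>D. (x, d) \<in> P"
    using way_below_imp_le[OF po xy] by (blast dest: transD)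
qed

lemma effective_map_compact_iff:
  assumes eff: "effective_presentation P p"
    and cpt: "\<And>n. way_below P (p n) (p n)"
    and V: "\<And>j. openin (scott Q) (V j)"
  shows "effective_map P (basic_open P p) Q V f \<longleftrightarrow>
    continuous_map (scott P) (scott Q) f \<and> ce_rel {(i, j). f ` basic_open P p i \<subseteq> V j}"
    (is "?L \<longleftrightarrow> ?C \<and> ce_rel ?A")
proof -
  have pres: "presentation P p" and ceB: "ce_rel {(k, i). way_below P (p k) (p i)}"
    using eff by (auto simp: effective_presentation_def)
  then have po: "Partial_order P" and basis: "domain_basis P (range p)"
    by (auto simp: presentation_def continuous_domain_def dcpo_def)
  have pF: "p n \<in> Field P" for n using cpt[of n] by (simp add: way_below_def)
  show ?thesis
  proof
    assume L: ?L
    then obtain W where W: "ce_rel W" "W \<subseteq> ?A"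
      and cov: "\<And>j. {x \<in> Field P. f x \<in> V j} = (\<Union>i\<in>{i. (i, j) \<in> W}. basic_open P p i)"
      unfolding effective_map_def by blast
    have "?A = {(i, j). \<exists>k. (k, j) \<in> W \<and> (k, i) \<in> {(k, i). way_below P (p k) (p i)}}"
    proof (intro set_eqI iffI; clarify)
      fix i j assume sub: "f ` basic_open P p i \<subseteq> V j"
      have "p i \<in> {x \<in> Field P. f x \<in> V j}"
        using sub cpt[of i] pF[of i] by (auto simp: basic_open_def)
      then show "\<exists>k. (k, j) \<in> W \<and> (k, i) \<in> {(k, i). way_below P (p k) (p i)}"
        unfolding cov by (auto simp: basic_open_def)
    next
      fix i j k x assume k: "(k, j) \<in> W" "way_below P (p k) (p i)" and x: "x \<in> basic_open P p i"
      then have "x \<in> basic_open P p k"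
        using way_below_trans[OF po] by (auto simp: basic_open_def)
      then show "f x \<in> V j" using k W by blast
    qed
    then have "ce_rel ?A" using ce_rel_compose[OF W(1) ceB] by simp
    then show "?C \<and> ce_rel ?A" using L by (simp add: effective_map_def)
  next
    assume R: "?C \<and> ce_rel ?A"
    have "{x \<in> Field P. f x \<in> V j} = (\<Union>i\<in>{i. (i, j) \<in> ?A}. basic_open P p i)" for j
    proof (intro set_eqI iffI)
      fix x assume x: "x \<in> {x \<in> Field P. f x \<in> V j}"
      let ?O = "{x \<in> Field P. f x \<in> V j}"
      have "scott_open P ?O"
        using openin_continuous_map_preimage[OF conjunct1[OF R] V[of j]]
        by (simp add: topspace_scott openin_scott)
      moreover have "directed P {b \<in> range p. way_below P b x}" "is_sup P {b \<in> range p. way_below P b x} x"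
        using basis x by (auto simp: domain_basis_def)
      ultimately have "{b \<in> range p. way_below P b x} \<inter> ?O \<noteq> {}"
        using x unfolding scott_open_def by blast
      then obtain i where i: "way_below P (p i) x" "p i \<in> ?O" by auto
      have "basic_open P p i \<subseteq> ?O"
        using i(2) \<open>scott_open P ?O\<close> way_below_imp_le[OF po]
        unfolding scott_open_def basic_open_def by blast
      then show "x \<in> (\<Union>i\<in>{i. (i, j) \<in> ?A}. basic_open P p i)"
        using i(1) by (auto simp: basic_open_def)
    next
      fix x assume "x \<in> (\<Union>i\<in>{i. (i, j) \<in> ?A}. basic_open P p i)"
      then show "x \<in> {x \<in> Field P. f x \<in> V j}"
        by (auto simp: basic_open_def way_below_def)
    qed
    then show ?L using R unfolding effective_map_def by blast
  qed
qed

end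

theory Submission
  imports Defs
begin

text \<open>A point \<open>z\<close> has rank \<open>\<beta>\<close> with respect to \<open>(A \<gamma>)\<close>, \<open>\<gamma> < \<alpha>\<close>, if \<open>\<beta>\<close> is least with \<open>z \<in> A \<beta>\<close>, and
  rank \<open>\<alpha>\<close> if there is no such \<open>\<beta>\<close>; membership in the difference set only depends on the parity of
  the rank. Ranks drop along the order and are eventually constant along directed suprema, so
  sending \<open>z\<close> to the member of an alternating chain indexed by the rank of \<open>z\<close> is a continuous
  reduction, and it is effective if the chain is. Conversely, open sets that give the members of a
  decreasing chain \<open>x\<close> ranks of the right parity yield a difference set whose reduction maps \<open>x\<close>
  to an alternating chain; in the sets of natural numbers such a chain is formed by the final
  segments of a copy of \<open>\<alpha> + 1\<close>.\<close>

section \<open>Recursive functions and c.e. relations\<close>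

text \<open>\<open>computable_rel\<close> is the binary case. Allowing every arity leaves room for
  the variable that a bounded quantifier binds.\<close>

definition decidable :: "nat \<Rightarrow> (nat list \<Rightarrow> bool) \<Rightarrow> bool" where
  "decidable n A \<longleftrightarrow> recursive n (\<lambda>xs. if A xs then 1 else 0)"

lemma decidable_cong:
  assumes "decidable n A" "\<And>xs. length xs = n \<Longrightarrow> A xs = B xs"
  shows "decidable n B"
  using assms unfolding decidable_def by (auto intro: recursive_cong)

lemma decidable_eq:
  assumes "recursive n f" "recursive n g"
  shows "decidable n (\<lambda>xs. f xs = g xs)"
  unfolding decidable_def by (intro recursive_if_eq assms recursive_const)

lemma recursive_if:
  assumes "decidable n A" "recursive n f" "recursive n g"
  shows "recursive n (\<lambda>xs. if A xs then f xs else g xs)"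
proof -
  have "recursive n (\<lambda>xs. if (if A xs then 1 else 0) = (1::nat) then f xs else g xs)"
    by (intro recursive_if_eq assms assms(1)[unfolded decidable_def] recursive_const)
  then show ?thesis by (rule ext) auto
qed

lemma decidable_not: "decidable n A \<Longrightarrow> decidable n (\<lambda>xs. \<not> A xs)"
  unfolding decidable_def[of n "\<lambda>xs. \<not> A xs"]
  using recursive_if[of n A "\<lambda>_. 0" "\<lambda>_. 1"] recursive_const
  by (auto intro: recursive_cong)

lemma decidable_conj:
  assumes "decidable n A" "decidable n B"
  shows "decidable n (\<lambda>xs. A xs \<and> B xs)"
proof -
  have "recursive n (\<lambda>xs. if A xs then if B xs then 1 else 0 else 0)"
    using assms(2) unfolding decidable_def
    by (intro recursive_if[OF assms(1)] recursive_const)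
  then show ?thesis unfolding decidable_def by (rule ext) auto
qed

lemma decidable_imp:
  assumes "decidable n A" "decidable n B"
  shows "decidable n (\<lambda>xs. A xs \<longrightarrow> B xs)"
  by (rule decidable_cong[OF decidable_not[OF decidable_conj[OF assms(1) decidable_not[OF assms(2)]]]])
    auto

lemma decidable_mem:
  assumes "computable_rel S" "recursive n f" "recursive n g"
  shows "decidable n (\<lambda>xs. (f xs, g xs) \<in> S)"
  using recursive_comp2[OF assms(1)[unfolded computable_rel_def] assms(2,3)]
  by (simp add: decidable_def)

text \<open>Search for the first number that refutes \<open>A\<close> or reaches the bound. Reaching
  the bound ends every search, so minimization applies, and the quantified statement holds exactly
  if the search ends no earlier than that.\<close>

lemma decidable_bounded_all:
  assumes A: "decidable (Suc n) A" and j: "j < n"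
  shows "decidable n (\<lambda>xs. \<forall>m<xs ! j. A (m # xs))"
proof -
  define L where "L xs = (LEAST k. (if A (k # xs) then (k # xs) ! Suc j - (k # xs) ! 0 else 0) = 0)"
    for xs
  have "recursive (Suc n) (\<lambda>ys. if A ys then ys ! Suc j - ys ! 0 else 0)"
    using j by (intro recursive_if A recursive_diff recursive_const proj) auto
  moreover have "\<exists>k. (if A (k # xs) then (k # xs) ! Suc j - (k # xs) ! 0 else 0) = 0" for xs
    by (rule exI[of _ "xs ! j"]) simp
  ultimately have "recursive n L" unfolding L_def by (rule minim)
  then have "decidable n (\<lambda>xs. xs ! j - L xs = 0)"
    using j by (intro decidable_eq recursive_diff proj recursive_const)
  moreover have "(xs ! j - L xs = 0) = (\<forall>m<xs ! j. A (m # xs))" for xs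
  proof
    assume "xs ! j - L xs = 0"
    then show "\<forall>m<xs ! j. A (m # xs)"
      unfolding L_def by (auto dest!: not_less_Least split: if_splits dest: less_le_trans)
  next
    assume all: "\<forall>m<xs ! j. A (m # xs)"
    have "(if A (L xs # xs) then (L xs # xs) ! Suc j - (L xs # xs) ! 0 else 0) = 0"
      unfolding L_def by (rule LeastI[of _ "xs ! j"]) simp
    then show "xs ! j - L xs = 0" using all by (cases "L xs < xs ! j") auto
  qed
  ultimately show ?thesis by simp
qed

section \<open>Binary digits and canonical finite sets\<close>

lemma rec_nat_half: "rec_nat 0 (\<lambda>k r. k - r) a = a div (2::nat)"
  by (induction a) auto

lemma rec_nat_div_power: "rec_nat b (\<lambda>k r. r div 2) a = b div (2::nat) ^ a"
  by (induction a) (simp_all add: div_mult2_eq [symmetric] mult.commute)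

text \<open>The recursion rests on (k + 1) div 2 = k - k div 2.\<close>

lemma recursive_half:
  assumes "recursive n f" shows "recursive n (\<lambda>xs. f xs div 2)"
proof -
  have "recursive (Suc 0) (\<lambda>xs. rec_nat ((\<lambda>ys. 0) (tl xs))
      (\<lambda>k r. (\<lambda>ys. ys ! 0 - ys ! 1) (k # r # tl xs)) (hd xs))"
    by (rule prim_rec) (auto intro!: recursive_diff proj zero)
  then have "recursive 1 (\<lambda>xs. xs ! 0 div 2)"
    by (rule recursive_cong) (auto simp: length_Suc_conv rec_nat_half)
  from recursive_comp1[OF this assms] show ?thesis by simp
qed

lemma recursive_div_power:
  assumes "recursive n f" "recursive n g" shows "recursive n (\<lambda>xs. f xs div 2 ^ g xs)"
proof -
  have "recursive (Suc 1) (\<lambda>xs. rec_nat ((\<lambda>ys. ys ! 0) (tl xs))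
      (\<lambda>k r. (\<lambda>ys. ys ! 1 div 2) (k # r # tl xs)) (hd xs))"
    by (rule prim_rec) (auto intro!: recursive_half proj)
  then have "recursive 2 (\<lambda>xs. xs ! 1 div 2 ^ (xs ! 0))"
    by (rule recursive_cong) (auto elim!: length2E simp: rec_nat_div_power)
  from recursive_comp2[OF this assms(2,1)] show ?thesis by simp
qed

lemma decidable_set_decode:
  assumes "recursive n f" "recursive n g"
  shows "decidable n (\<lambda>xs. f xs \<in> set_decode (g xs))"
proof -
  let ?h = "\<lambda>xs. g xs div 2 ^ f xs"
  \<comment> \<open>Digit \<open>f xs\<close> of \<open>g xs\<close> is 1 exactly if the quotient
    \<open>?h xs\<close> is odd, that is, differs from twice its half.\<close>
  have "decidable n (\<lambda>xs. \<not> ?h xs = ?h xs div 2 + ?h xs div 2)"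
    by (intro decidable_not decidable_eq recursive_add recursive_half recursive_div_power assms)
  moreover have "(\<not> ?h xs = ?h xs div 2 + ?h xs div 2) = (f xs \<in> set_decode (g xs))" for xs
    unfolding set_decode_def mem_Collect_eq by (metis dvd_triv_left even_two_times_div_two mult_2)
  ultimately show ?thesis by simp
qed

text \<open>Bounds quantification over a canonical finite set by the code of the set, which makes
  inclusions of such sets decidable.\<close>

lemma set_decode_less: "m \<in> set_decode i \<Longrightarrow> m < i"
proof -
  assume "m \<in> set_decode i"
  then have "i div 2 ^ m \<noteq> 0" by (auto simp: set_decode_def dest: odd_pos)
  then have "2 ^ m \<le> i" by (auto simp: div_eq_0_iff)
  then show "m < i" using less_exp[of m] by (rule less_le_trans[rotated])
qed

section \<open>Closure properties of c.e. relations\<close>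

lemma computable_relI:
  assumes "decidable 2 (\<lambda>xs. A (xs ! 0) (xs ! 1))" shows "computable_rel {(a, b). A a b}"
  using assms by (simp add: computable_rel_def decidable_def)

lemma ce_rel_filter:
  assumes "decidable 1 A" "recursive 1 f" "recursive 1 g"
  shows "ce_rel {(f [k], g [k]) |k. A [k]}"
proof (cases "\<exists>k. A [k]")
  case True
  then obtain k0 where k0: "A [k0]" ..
  \<comment> \<open>Discarded stages repeat the pair of stage \<open>k0\<close>, which keeps the
    enumeration total.\<close>
  let ?f = "\<lambda>xs. if A xs then f xs else f [k0]" and ?g = "\<lambda>xs. if A xs then g xs else g [k0]"
  have "recursive 1 ?f" "recursive 1 ?g" by (intro recursive_if assms recursive_const)+
  moreover have "{(f [k], g [k]) |k. A [k]} = range (\<lambda>k. (?f [k], ?g [k]))"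
    using k0 by (auto simp: image_iff)
  ultimately show ?thesis unfolding ce_rel_def by (intro disjI2 exI conjI)
next
  case False
  then show ?thesis by (auto simp: ce_rel_def)
qed

text \<open>Enumerate all pairs of numbers and keep those that pass the test.\<close>

lemma ce_rel_computable:
  assumes "computable_rel S" shows "ce_rel S"
proof -
  obtain g h where gh: "recursive 1 g" "recursive 1 h" "\<And>s t. \<exists>k. g [k] = s \<and> h [k] = t"
    using recursive_pair_enum by blast
  have "ce_rel {(g [k], h [k]) |k. (g [k], h [k]) \<in> S}"
    by (rule ce_rel_filter[OF decidable_mem[OF assms gh(1,2)] gh(1,2)])
  also have "{(g [k], h [k]) |k. (g [k], h [k]) \<in> S} = S" using gh(3) by auto metis
  finally show ?thesis .
qed

lemma ce_rel_Int_computable: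
  assumes W: "ce_rel W" and S: "computable_rel S" shows "ce_rel (W \<inter> S)"
proof (cases "W = {}")
  case False
  then obtain f g where fg: "recursive 1 f" "recursive 1 g" "W = range (\<lambda>k. (f [k], g [k]))"
    using W unfolding ce_rel_def by blast
  have "ce_rel {(f [k], g [k]) |k. (f [k], g [k]) \<in> S}"
    by (rule ce_rel_filter[OF decidable_mem[OF S fg(1,2)] fg(1,2)])
  also have "{(f [k], g [k]) |k. (f [k], g [k]) \<in> S} = W \<inter> S" using fg(3) by auto
  finally show ?thesis .
qed (simp add: ce_rel_def)

lemma ce_rel_Un:
  assumes V: "ce_rel V" and W: "ce_rel W" shows "ce_rel (V \<union> W)"
proof (cases "V = {} \<or> W = {}")
  case False
  obtain a b where ab: "recursive 1 a" "recursive 1 b" "V = range (\<lambda>k. (a [k], b [k]))"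
    using V False unfolding ce_rel_def by blast
  obtain c d where cd: "recursive 1 c" "recursive 1 d" "W = range (\<lambda>k. (c [k], d [k]))"
    using W False unfolding ce_rel_def by blast
  obtain g h where gh: "recursive 1 g" "recursive 1 h" "\<And>s t. \<exists>k. g [k] = s \<and> h [k] = t"
    using recursive_pair_enum by blast
  \<comment> \<open>The first component of the coded pair selects the enumeration, the second the
    stage.\<close>
  let ?F = "\<lambda>xs. if g xs = 0 then a [h xs] else c [h xs]"
  let ?G = "\<lambda>xs. if g xs = 0 then b [h xs] else d [h xs]"
  have "recursive 1 ?F" "recursive 1 ?G"
    by (intro recursive_if_eq recursive_const gh recursive_comp1[OF ab(1)] recursive_comp1[OF ab(2)]
        recursive_comp1[OF cd(1)] recursive_comp1[OF cd(2)])+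
  moreover have "V \<union> W = range (\<lambda>k. (?F [k], ?G [k]))"
  proof (intro subset_antisym subsetI)
    fix z assume "z \<in> V \<union> W"
    then consider t where "z = (a [t], b [t])" | t where "z = (c [t], d [t])"
      using ab(3) cd(3) by auto
    then show "z \<in> range (\<lambda>k. (?F [k], ?G [k]))"
    proof cases
      case (1 t)
      obtain k where "g [k] = 0" "h [k] = t" using gh(3) by blast
      then show ?thesis using 1 by (intro image_eqI[of _ _ k]) auto
    next
      case (2 t)
      obtain k where "g [k] = 1" "h [k] = t" using gh(3) by blast
      then show ?thesis using 2 by (intro image_eqI[of _ _ k]) auto
    qed
  qed (use ab(3) cd(3) in auto)
  ultimately show ?thesis unfolding ce_rel_def by (intro disjI2 exI conjI)
qed (use V W in auto)

lemma ce_rel_UN_finite: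
  assumes "finite T" "\<And>t. t \<in> T \<Longrightarrow> ce_rel (W t)" shows "ce_rel (\<Union>t\<in>T. W t)"
  using assms
proof (induction T rule: finite_induct)
  case empty
  show ?case by (simp add: ce_rel_def)
next
  case (insert t F)
  then show ?case by (simp add: ce_rel_Un)
qed

lemma ce_rel_converse: "ce_rel W \<Longrightarrow> ce_rel (W\<inverse>)"
  unfolding ce_rel_def by (fastforce simp: image_iff)

text \<open>Composition quantifies existentially over the middle term. The sets of pairs needed for
  reductions and chains are built this way from codes of ordinals and basis indices.\<close>

lemma ce_rel_relcomp:
  assumes "ce_rel V" "ce_rel W" shows "ce_rel (V O W)"
proof -
  have "V O W = {(i, j). \<exists>k. (k, j) \<in> W \<and> (k, i) \<in> V\<inverse>}" by auto
  then show ?thesis using ce_rel_compose[OF assms(2) ce_rel_converse[OF assms(1)]] by simp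
qed

section \<open>Domains\<close>

lemma po_refl: "Partial_order P \<Longrightarrow> x \<in> Field P \<Longrightarrow> (x, x) \<in> P"
  by (auto simp: partial_order_on_def preorder_on_def refl_on_def)

lemma po_trans: "Partial_order P \<Longrightarrow> (x, y) \<in> P \<Longrightarrow> (y, z) \<in> P \<Longrightarrow> (x, z) \<in> P"
  by (auto simp: partial_order_on_def preorder_on_def dest: transD)

lemma po_antisym: "Partial_order P \<Longrightarrow> (x, y) \<in> P \<Longrightarrow> (y, x) \<in> P \<Longrightarrow> x = y"
  by (auto simp: partial_order_on_def dest: antisymD)

lemma continuous_domain_po: "continuous_domain P \<Longrightarrow> Partial_order P"
  by (simp add: continuous_domain_def dcpo_def)

lemma presentation_po: "presentation P p \<Longrightarrow> Partial_order P"
  by (simp add: presentation_def continuous_domain_po)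

lemma way_below_le_trans:
  assumes po: "Partial_order P" and "way_below P x y" "(y, z) \<in> P"
  shows "way_below P x z"
  using assms po_trans[OF po] unfolding way_below_def by (blast intro: FieldI2)

lemma le_way_below_trans:
  assumes po: "Partial_order P" and "(w, x) \<in> P" "way_below P x y"
  shows "way_below P w y"
  using assms po_trans[OF po] unfolding way_below_def by (blast intro: FieldI1)

text \<open>If a supremum is not below \<open>y\<close>, then \<open>y\<close> is not an upper
  bound, so some member of the directed set is not below \<open>y\<close> either.\<close>

lemma scott_open_not_below:
  assumes po: "Partial_order P" and y: "y \<in> Field P"
  shows "scott_open P {z \<in> Field P. (z, y) \<notin> P}"
  unfolding scott_open_def
proof (intro conjI allI impI)
  show "w \<in> {z \<in> Field P. (z, y) \<notin> P}" if "z \<in> {z \<in> Field P. (z, y) \<notin> P} \<and> (z, w) \<in> P" for z w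
    using that po_trans[OF po] by (blast intro: FieldI2)
  fix D s assume D: "directed P D \<and> is_sup P D s \<and> s \<in> {z \<in> Field P. (z, y) \<notin> P}"
  then obtain d where "d \<in> D" "(d, y) \<notin> P" using y unfolding is_sup_def by blast
  moreover have "D \<subseteq> Field P" using D by (simp add: directed_def)
  ultimately show "D \<inter> {z \<in> Field P. (z, y) \<notin> P} \<noteq> {}" by blast
qed auto

text \<open>If \<open>f x\<close> were not below \<open>f y\<close>, the preimage of the complement
  of the principal ideal of \<open>f y\<close> would be an open set containing \<open>x\<close> but
  not \<open>y\<close>, although open sets are upward closed.\<close>

lemma scott_continuous_mono:
  assumes P: "Partial_order P" and Q: "Partial_order Q"
    and f: "continuous_map (scott P) (scott Q) f" and xy: "(x, y) \<in> P"
  shows "(f x, f y) \<in> Q"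
proof (rule ccontr)
  assume n: "(f x, f y) \<notin> Q"
  have F: "x \<in> Field P" "y \<in> Field P" using xy by (auto simp: Field_def)
  then have fF: "f x \<in> Field Q" "f y \<in> Field Q"
    using f by (auto simp: continuous_map_def topspace_scott)
  have "scott_open P {z \<in> Field P. f z \<in> {w \<in> Field Q. (w, f y) \<notin> Q}}"
    using openin_continuous_map_preimage[OF f, of "{w \<in> Field Q. (w, f y) \<notin> Q}"]
      scott_open_not_below[OF Q fF(2)]
    by (simp add: openin_scott topspace_scott)
  then have "y \<in> {z \<in> Field P. f z \<in> {w \<in> Field Q. (w, f y) \<notin> Q}}"
    using F fF n xy unfolding scott_open_def by blast
  then show False using po_refl[OF Q fF(2)] by simp
qed

text \<open>An interpolation argument. Each member of \<open>D\<close> is the directed supremum of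
  the basis elements approximating it; pooling these gives a directed set \<open>E\<close> with the
  same supremum as \<open>D\<close>. So \<open>a\<close> is below some element of \<open>E\<close>,
  which approximates a member of \<open>D\<close>.\<close>

lemma scott_open_way_above:
  assumes P: "Partial_order P" and basis: "domain_basis P B"
  shows "scott_open P {y. way_below P a y}"
  unfolding scott_open_def
proof (intro conjI allI impI)
  show "{y. way_below P a y} \<subseteq> Field P" by (auto simp: way_below_def)
  show "y \<in> {y. way_below P a y}" if "x \<in> {y. way_below P a y} \<and> (x, y) \<in> P" for x y
    using that way_below_le_trans[OF P] by auto
  fix D s assume *: "directed P D \<and> is_sup P D s \<and> s \<in> {y. way_below P a y}"
  then have D: "directed P D" "is_sup P D s" "way_below P a s" by auto
  define E where "E = {b \<in> B. \<exists>d\<in>D. way_below P b d}"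
  have dirb: "directed P {b \<in> B. way_below P b d}" and supb: "is_sup P {b \<in> B. way_below P b d} d"
    if "d \<in> D" for d
    using that D(1) basis by (auto simp: directed_def domain_basis_def)
  have "directed P E"
    unfolding directed_def
  proof (intro conjI ballI)
    show "E \<subseteq> Field P" using basis by (auto simp: E_def domain_basis_def)
    show "E \<noteq> {}" using D(1) dirb unfolding E_def directed_def by blast
    fix b c assume "b \<in> E" "c \<in> E"
    then obtain d d' where d: "b \<in> B" "c \<in> B" "d \<in> D" "d' \<in> D" "way_below P b d" "way_below P c d'"
      unfolding E_def by blast
    then obtain e where e: "e \<in> D" "(d, e) \<in> P" "(d', e) \<in> P"
      using D(1) unfolding directed_def by blast
    then have "way_below P b e" "way_below P c e"
      using d way_below_le_trans[OF P] by blast+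
    then obtain z where "z \<in> B" "way_below P z e" "(b, z) \<in> P" "(c, z) \<in> P"
      using dirb[OF e(1)] d unfolding directed_def by blast
    then show "\<exists>z\<in>E. (b, z) \<in> P \<and> (c, z) \<in> P" using e(1) unfolding E_def by blast
  qed
  moreover have "is_sup P E s"
    unfolding is_sup_def
  proof (intro conjI ballI impI)
    show "s \<in> Field P" using D(2) by (simp add: is_sup_def)
    show "(b, s) \<in> P" if "b \<in> E" for b
      using that D(2) way_below_imp_le[OF P] po_trans[OF P] unfolding E_def is_sup_def by blast
    fix u assume u: "u \<in> Field P" "\<forall>x\<in>E. (x, u) \<in> P"
    have "(d, u) \<in> P" if "d \<in> D" for d
      using supb[OF that] u that unfolding is_sup_def E_def by blast
    then show "(s, u) \<in> P" using D(2) u(1) by (simp add: is_sup_def)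
  qed
  moreover have "(s, s) \<in> P" using po_refl[OF P] D(2) by (simp add: is_sup_def)
  ultimately obtain b where "b \<in> E" "(a, b) \<in> P" using D(3) unfolding way_below_def by blast
  then show "D \<inter> {y. way_below P a y} \<noteq> {}"
    using le_way_below_trans[OF P] unfolding E_def by blast
qed

text \<open>Otherwise \<open>y\<close> would bound all basis elements approximating
  \<open>x\<close>, and hence their supremum \<open>x\<close>.\<close>

lemma basis_separates:
  assumes basis: "domain_basis P B" and xy: "x \<in> Field P" "y \<in> Field P" "(x, y) \<notin> P"
    and P: "Partial_order P"
  shows "\<exists>b\<in>B. way_below P b x \<and> \<not> way_below P b y"
proof (rule ccontr)
  assume "\<not> ?thesis"
  then have "\<forall>b\<in>{b \<in> B. way_below P b x}. (b, y) \<in> P" using way_below_imp_le[OF P] by blast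
  then show False using basis xy unfolding domain_basis_def is_sup_def by blast
qed

text \<open>There need not be a least element, so covering the space depends on each point having
  some approximant; directed sets provide one by being nonempty.\<close>

lemma UN_basic_open:
  assumes "presentation P p" shows "(\<Union>i. basic_open P p i) = Field P"
proof
  show "(\<Union>i. basic_open P p i) \<subseteq> Field P" by (auto simp: basic_open_def way_below_def)
  show "Field P \<subseteq> (\<Union>i. basic_open P p i)"
    using assms by (fastforce simp: presentation_def domain_basis_def directed_def basic_open_def)
qed

lemma openin_basic_open:
  assumes "presentation P p" shows "openin (scott P) (basic_open P p i)"
  using assms scott_open_way_above[of P "range p" "p i"]
  by (simp add: openin_scott basic_open_def presentation_def continuous_domain_po)

section \<open>Parity of ordinals\<close>

lemma imm_succ_left_unique: "imm_succ \<gamma> \<beta> \<Longrightarrow> imm_succ \<gamma>' \<beta> \<Longrightarrow> \<gamma> = \<gamma>'"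
  unfolding imm_succ_def by (metis linorder_neqE)

text \<open>A successor is even only by the rule \<open>add_two\<close>, and its predecessor is
  unique. So \<delta> is even exactly if \<beta> is itself the successor of an even element, and by
  induction exactly if \<beta> is odd.\<close>

lemma even_ord_imm_succ: "imm_succ \<beta> \<delta> \<Longrightarrow> even_ord \<delta> \<longleftrightarrow> \<not> even_ord \<beta>"
proof (induction \<beta> arbitrary: \<delta> rule: less_induct)
  case (less \<beta>)
  have *: "even_ord \<delta> \<longleftrightarrow> (\<exists>\<gamma>. even_ord \<gamma> \<and> imm_succ \<gamma> \<beta>)"
    using less.prems even_ord.simps[of \<delta>] imm_succ_left_unique[OF less.prems] by metis
  show ?case
  proof (cases "\<exists>\<gamma>. imm_succ \<gamma> \<beta>")
    case True
    then obtain \<gamma> where g: "imm_succ \<gamma> \<beta>" ..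
    then have "even_ord \<beta> \<longleftrightarrow> \<not> even_ord \<gamma>" using less.IH by (simp add: imm_succ_def)
    then show ?thesis using * g by (auto dest: imm_succ_left_unique)
  next
    case False
    then show ?thesis using * even_ord.zero_or_limit by blast
  qed
qed

text \<open>The type may have a greatest element, hence the bound \<alpha> above \<beta>.\<close>

lemma imm_succ_exists:
  assumes "(\<beta>::'i::wellorder) < \<alpha>" obtains \<sigma> where "imm_succ \<beta> \<sigma>" "\<sigma> \<le> \<alpha>"
proof
  show "imm_succ \<beta> (LEAST \<delta>. \<beta> < \<delta>)"
    unfolding imm_succ_def using LeastI[of "\<lambda>\<delta>. \<beta> < \<delta>", OF assms] not_less_Least by blast
  show "(LEAST \<delta>. \<beta> < \<delta>) \<le> \<alpha>" by (rule Least_le) (rule assms)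
qed

lemma imm_succ_le_iff: "imm_succ \<beta> \<sigma> \<Longrightarrow> \<sigma> \<le> \<delta> \<longleftrightarrow> \<beta> < \<delta>"
  unfolding imm_succ_def by (meson leI less_le_trans)

section \<open>Ranks and difference sets\<close>

text \<open>The implication makes \<alpha> a vacuous candidate, so a least one always exists and
  \<alpha> is the default for points outside all the sets.\<close>

definition rank :: "'i::wellorder \<Rightarrow> ('i \<Rightarrow> 'a set) \<Rightarrow> 'a \<Rightarrow> 'i" where
  "rank \<alpha> A x = (LEAST \<beta>. \<beta> < \<alpha> \<longrightarrow> x \<in> A \<beta>)"

lemma rank_le: "rank \<alpha> A x \<le> \<alpha>"
  unfolding rank_def by (rule Least_le) simp

lemma rank_le_mem: "\<beta> < \<alpha> \<Longrightarrow> x \<in> A \<beta> \<Longrightarrow> rank \<alpha> A x \<le> \<beta>"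
  unfolding rank_def by (rule Least_le) simp

lemma mem_rank: "rank \<alpha> A x < \<alpha> \<Longrightarrow> x \<in> A (rank \<alpha> A x)"
  unfolding rank_def using LeastI[of "\<lambda>\<beta>. \<beta> < \<alpha> \<longrightarrow> x \<in> A \<beta>" \<alpha>] by blast

lemma rank_eqI:
  assumes "r \<le> \<alpha>" "r < \<alpha> \<Longrightarrow> x \<in> A r" "\<And>\<beta>. \<beta> < r \<Longrightarrow> x \<notin> A \<beta>"
  shows "rank \<alpha> A x = r"
  unfolding rank_def using assms by (intro Least_equality) (auto intro: leI)

text \<open>The default rank \<alpha> has the parity of \<alpha>, so a rank of the other parity is
  below \<alpha> and is the first index whose set contains \<open>x\<close>.\<close>

lemma diff_set_iff_rank: "x \<in> diff_set \<alpha> A \<longleftrightarrow> \<not> same_parity (rank \<alpha> A x) \<alpha>"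
proof
  assume "x \<in> diff_set \<alpha> A"
  then obtain \<beta> where b: "\<beta> < \<alpha>" "\<not> same_parity \<beta> \<alpha>" "x \<in> A \<beta>" "\<And>\<gamma>. \<gamma> < \<beta> \<Longrightarrow> x \<notin> A \<gamma>"
    unfolding diff_set_def by auto
  then have "rank \<alpha> A x = \<beta>" by (intro rank_eqI) auto
  then show "\<not> same_parity (rank \<alpha> A x) \<alpha>" using b by simp
next
  assume np: "\<not> same_parity (rank \<alpha> A x) \<alpha>"
  then have "rank \<alpha> A x < \<alpha>"
    using rank_le[of \<alpha> A x] by (cases "rank \<alpha> A x = \<alpha>") (auto simp: same_parity_def)
  moreover have "x \<notin> A \<gamma>" if "\<gamma> < rank \<alpha> A x" for \<gamma>
    using that rank_le_mem[of \<gamma> \<alpha> x A] \<open>rank \<alpha> A x < \<alpha>\<close> by fastforce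
  ultimately show "x \<in> diff_set \<alpha> A" unfolding diff_set_def using np mem_rank[of \<alpha> A x] by auto
qed

section \<open>From chains to hardness\<close>

lemma decreasing_chain_le:
  assumes "Partial_order P" "decreasing_chain P \<alpha> x" "\<beta> \<le> \<delta>" "\<delta> \<le> \<alpha>"
  shows "(x \<delta>, x \<beta>) \<in> P"
  using assms po_refl[of P "x \<beta>"] unfolding decreasing_chain_def
  by (cases "\<beta> = \<delta>") auto

text \<open>\<open>V\<close> is upward closed and \<open>x\<close> decreasing, so the indices with
  \<open>x \<beta>\<close> in \<open>V\<close> form an initial segment. Hence the least index of a
  set containing \<open>p\<close> may be replaced by any such index, with \<alpha> always counted as
  one.\<close>

lemma chain_rank_preimage:
  assumes Q: "Partial_order Q" and x: "decreasing_chain Q \<alpha> x" and V: "scott_open Q V"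
  shows "x (rank \<alpha> A p) \<in> V \<longleftrightarrow> x \<alpha> \<in> V \<or> (\<exists>\<beta><\<alpha>. x \<beta> \<in> V \<and> p \<in> A \<beta>)"
proof -
  have up: "x \<beta> \<in> V" if "\<beta> \<le> \<delta>" "\<delta> \<le> \<alpha>" "x \<delta> \<in> V" for \<beta> \<delta>
    using V that decreasing_chain_le[OF Q x that(1,2)] unfolding scott_open_def by blast
  show ?thesis
    using up[OF rank_le[of \<alpha> A p]] up[OF rank_le_mem[of _ \<alpha> p A]] mem_rank[of \<alpha> A p]
      rank_le[of \<alpha> A p] by (metis less_imp_le order.refl le_neq_trans)
qed

lemma continuous_chain_rank:
  assumes Q: "Partial_order Q" and x: "decreasing_chain Q \<alpha> x"
    and A: "\<And>\<beta>. \<beta> < \<alpha> \<Longrightarrow> openin (scott P) (A \<beta>)"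
  shows "continuous_map (scott P) (scott Q) (\<lambda>p. x (rank \<alpha> A p))"
  unfolding continuous_map_def
proof (intro conjI allI impI)
  show "(\<lambda>p. x (rank \<alpha> A p)) \<in> topspace (scott P) \<rightarrow> topspace (scott Q)"
    using x rank_le[of \<alpha> A] by (auto simp: decreasing_chain_def topspace_scott)
  fix V assume "openin (scott Q) V"
  then have V: "scott_open Q V" by (simp add: openin_scott)
  \<comment> \<open>If \<open>V\<close> contains the least member \<open>x \<alpha>\<close>, it
    contains the whole chain; otherwise the preimage is a union of the given open sets.\<close>
  have "{p \<in> topspace (scott P). x (rank \<alpha> A p) \<in> V} =
    (if x \<alpha> \<in> V then topspace (scott P) else \<Union>\<beta>\<in>{\<beta>. \<beta> < \<alpha> \<and> x \<beta> \<in> V}. A \<beta>)"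
    using A[THEN openin_subset] by (auto simp: chain_rank_preimage[OF Q x V])
  then show "openin (scott P) {p \<in> topspace (scott P). x (rank \<alpha> A p) \<in> V}"
    using A by auto
qed

lemma alternating_chain_diff_set:
  assumes "alternating_chain Q H \<alpha> x" "\<And>\<beta>. \<beta> < \<alpha> \<Longrightarrow> A \<beta> \<subseteq> Field P"
  shows "diff_set \<alpha> A = {p \<in> Field P. x (rank \<alpha> A p) \<in> H}"
proof -
  have "diff_set \<alpha> A \<subseteq> Field P" using assms(2) by (auto simp: diff_set_def)
  moreover have "p \<in> diff_set \<alpha> A \<longleftrightarrow> x (rank \<alpha> A p) \<in> H" for p
    using assms(1) rank_le[of \<alpha> A p] by (auto simp: diff_set_iff_rank alternating_chain_def)
  ultimately show ?thesis by auto
qed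

lemma alternating_chain_wadge_hard:
  assumes Q: "Partial_order Q" and x: "alternating_chain Q H \<alpha> x"
  shows "wadge_hard P Q H (diff_class \<alpha> P)"
  unfolding wadge_hard_def
proof
  fix X assume "X \<in> diff_class \<alpha> P"
  then obtain A where A: "X = diff_set \<alpha> A" "\<And>\<beta>. \<beta> < \<alpha> \<Longrightarrow> openin (scott P) (A \<beta>)"
    by (auto simp: diff_class_def)
  have "X = {p \<in> Field P. x (rank \<alpha> A p) \<in> H}"
    unfolding A(1) using A(2)[THEN openin_subset]
    by (intro alternating_chain_diff_set[OF x]) (simp add: topspace_scott)
  moreover have "decreasing_chain Q \<alpha> x" using x by (simp add: alternating_chain_def)
  ultimately show "\<exists>f. continuous_map (scott P) (scott Q) f \<and> X = {x \<in> Field P. f x \<in> H}"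
    using continuous_chain_rank[of Q \<alpha> x P A, OF Q _ A(2)] by blast
qed

section \<open>Effective reductions from effective chains\<close>

lemma computable_copy_inv:
  assumes "computable_copy R \<rho> S" "\<beta> \<in> S"
  shows "inv_into (Field R) \<rho> \<beta> \<in> Field R" "\<rho> (inv_into (Field R) \<rho> \<beta>) = \<beta>"
  using assms by (auto simp: computable_copy_def bij_betw_def inv_into_into f_inv_into_f)

text \<open>The reduction takes \<open>z\<close> to \<open>x (rank \<alpha> A z)\<close>. By
  \<open>chain_rank_preimage\<close>, the preimage of a basic open set is the union of the
  \<open>A \<beta>\<close> for which \<open>x \<beta>\<close> lies in it. Joining the enumeration of
  \<open>A\<close> with that of the chain along common codes \<open>n\<close> enumerates this
  union.\<close>

lemma alternating_chain_eff_wadge_hard: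
  assumes Q: "presentation Q q" and P: "presentation P p" and R: "computable_copy R \<rho> {..\<alpha>}"
    and x: "alternating_chain Q H \<alpha> x" and ce: "ce_rel (chain_rel Q q R \<rho> x)"
  shows "eff_wadge_hard P p Q q H (eff_diff_class R \<rho> \<alpha> (basic_open P p))"
  unfolding eff_wadge_hard_def
proof
  fix X assume "X \<in> eff_diff_class R \<rho> \<alpha> (basic_open P p)"
  then obtain A W where X: "X = diff_set \<alpha> A" and W: "ce_rel W"
    and AW: "\<And>n. n \<in> Field R \<Longrightarrow> \<rho> n < \<alpha> \<Longrightarrow> A (\<rho> n) = (\<Union>i\<in>{i. (n, i) \<in> W}. basic_open P p i)"
    by (auto simp: eff_diff_class_def)
  define N where "N = inv_into (Field R) \<rho>"
  have N: "N \<beta> \<in> Field R" "\<rho> (N \<beta>) = \<beta>" if "\<beta> \<le> \<alpha>" for \<beta>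
    using computable_copy_inv[OF R] that by (auto simp: N_def)
  have A: "openin (scott P) (A \<beta>)" if "\<beta> < \<alpha>" for \<beta>
    using AW[of "N \<beta>"] N[of \<beta>] that openin_basic_open[OF P] by auto
  note Qpo = presentation_po[OF Q]
  have dx: "decreasing_chain Q \<alpha> x" using x by (simp add: alternating_chain_def)
  \<comment> \<open>The missing \<open>A \<alpha>\<close> is taken to be the whole space.\<close>
  define W' where "W' = W \<inter> {(n, i). n \<noteq> N \<alpha>} \<union> {(n, i). n = N \<alpha>}"
  have "ce_rel W'"
    unfolding W'_def
    by (intro ce_rel_Un ce_rel_Int_computable[OF W] ce_rel_computable computable_relI
        decidable_not decidable_eq recursive_const proj) auto
  then have ceW: "ce_rel (W'\<inverse> O chain_rel Q q R \<rho> x)"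
    by (intro ce_rel_relcomp ce_rel_converse ce)
  let ?f = "\<lambda>z. x (rank \<alpha> A z)"
  have pre: "{z \<in> Field P. ?f z \<in> basic_open Q q j} =
      (\<Union>i\<in>{i. (i, j) \<in> W'\<inverse> O chain_rel Q q R \<rho> x}. basic_open P p i)" (is "?L = ?Rt") for j
  proof -
    have so: "scott_open Q (basic_open Q q j)"
      using openin_basic_open[OF Q] by (simp add: openin_scott)
    \<comment> \<open>As \<rho> is injective, \<open>N \<alpha>\<close> is the only code of
      \<alpha>, so exactly the row of \<alpha> is replaced.\<close>
    have W'N: "(n, i) \<in> W' \<longleftrightarrow> (if \<rho> n = \<alpha> then True else (n, i) \<in> W)" if "n \<in> Field R" for n i
    proof -
      have "n = N \<alpha> \<longleftrightarrow> \<rho> n = \<alpha>"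
        using R that N[of \<alpha>] by (auto simp: computable_copy_def bij_betw_def dest: inj_onD)
      then show ?thesis by (auto simp: W'_def)
    qed
    have un: "(\<Union>i\<in>{i. (n, i) \<in> W'}. basic_open P p i) = (if \<rho> n = \<alpha> then Field P else A (\<rho> n))"
      if "n \<in> Field R" for n
    proof -
      have "\<rho> n \<le> \<alpha>" using R that by (auto simp: computable_copy_def bij_betw_def)
      then show ?thesis using W'N[OF that] AW[OF that] UN_basic_open[OF P] by auto
    qed
    \<comment> \<open>Regroup the union by codes, identify each row, then pass from codes to
      ordinals.\<close>
    have "?Rt = (\<Union>n\<in>{n \<in> Field R. x (\<rho> n) \<in> basic_open Q q j}.
        \<Union>i\<in>{i. (n, i) \<in> W'}. basic_open P p i)"
      by (auto simp: chain_rel_def basic_open_def)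
    also have "\<dots> = (\<Union>n\<in>{n \<in> Field R. x (\<rho> n) \<in> basic_open Q q j}.
        if \<rho> n = \<alpha> then Field P else A (\<rho> n))"
      using un by auto
    also have "\<dots> = (\<Union>\<beta>\<in>\<rho> ` Field R. if x \<beta> \<in> basic_open Q q j then
        if \<beta> = \<alpha> then Field P else A \<beta> else {})"
      by (auto split: if_splits)
    also have "\<rho> ` Field R = {..\<alpha>}" using R by (simp add: computable_copy_def bij_betw_def)
    also have "(\<Union>\<beta>\<in>{..\<alpha>}. if x \<beta> \<in> basic_open Q q j then
        if \<beta> = \<alpha> then Field P else A \<beta> else {}) = ?L"
      using A[THEN openin_subset]
      by (auto simp: chain_rank_preimage[OF Qpo dx so] topspace_scott split: if_splits
          intro: less_imp_le dest: le_neq_trans)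
    finally show ?thesis by simp
  qed
  have "effective_map P (basic_open P p) Q (basic_open Q q) ?f"
    unfolding effective_map_def
  proof (intro conjI exI[of _ "W'\<inverse> O chain_rel Q q R \<rho> x"] allI)
    show "continuous_map (scott P) (scott Q) ?f"
      by (rule continuous_chain_rank[OF Qpo dx A])
    show "W'\<inverse> O chain_rel Q q R \<rho> x \<subseteq> {(i, j). ?f ` basic_open P p i \<subseteq> basic_open Q q j}"
      using pre by blast
  qed (fact ceW pre)+
  moreover have "X = {z \<in> Field P. ?f z \<in> H}"
    unfolding X using A[THEN openin_subset]
    by (intro alternating_chain_diff_set[OF x]) (simp add: topspace_scott)
  ultimately show "\<exists>f. effective_map P (basic_open P p) Q (basic_open Q q) f \<and>
      X = {x \<in> Field P. f x \<in> H}"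
    by blast
qed

section \<open>From hardness to chains\<close>

text \<open>Strictness comes from alternation: equal images at \<beta> < \<delta> would by
  monotonicity force the same image at the successor of \<beta>, whose parity and hence membership
  in \<open>H\<close> differs. Asking only for the parity of the ranks leaves room for the shift in
  \<open>eff_diff_class_separating\<close>.\<close>

lemma alternating_chain_image:
  assumes P: "Partial_order P" and Q: "Partial_order Q"
    and f: "continuous_map (scott P) (scott Q) f" and x: "decreasing_chain P \<alpha> x"
    and rk: "\<And>\<beta>. \<beta> \<le> \<alpha> \<Longrightarrow> same_parity (rank \<alpha> A (x \<beta>)) \<beta>"
    and fH: "diff_set \<alpha> A = {z \<in> Field P. f z \<in> H}"
  shows "alternating_chain Q H \<alpha> (\<lambda>\<beta>. f (x \<beta>))"
proof -
  have xF: "x \<beta> \<in> Field P" if "\<beta> \<le> \<alpha>" for \<beta> using x that by (simp add: decreasing_chain_def)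
  have H: "f (x \<beta>) \<in> H \<longleftrightarrow> \<not> same_parity \<beta> \<alpha>" if "\<beta> \<le> \<alpha>" for \<beta>
    using xF[OF that] fH diff_set_iff_rank[of "x \<beta>" \<alpha> A] rk[OF that] by (auto simp: same_parity_def)
  have le: "(f (x \<delta>), f (x \<beta>)) \<in> Q" if "\<beta> \<le> \<delta>" "\<delta> \<le> \<alpha>" for \<beta> \<delta>
    by (rule scott_continuous_mono[OF P Q f decreasing_chain_le[OF P x that]])
  have "f (x \<delta>) \<noteq> f (x \<beta>)" if bd: "\<beta> < \<delta>" "\<delta> \<le> \<alpha>" for \<beta> \<delta>
  proof
    assume eq: "f (x \<delta>) = f (x \<beta>)"
    obtain \<sigma> where s: "imm_succ \<beta> \<sigma>" "\<sigma> \<le> \<delta>" using imm_succ_exists[OF bd(1)] by blast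
    then have "\<beta> \<le> \<sigma>" "\<sigma> \<le> \<alpha>" using bd by (auto simp: imm_succ_def)
    then have "f (x \<sigma>) = f (x \<beta>)"
      using le[OF s(2) bd(2)] le[of \<beta> \<sigma>] po_antisym[OF Q] eq by auto
    then show False
      using H[of \<beta>] H[of \<sigma>] \<open>\<sigma> \<le> \<alpha>\<close> \<open>\<beta> \<le> \<sigma>\<close> even_ord_imm_succ[OF s(1)] by (auto simp: same_parity_def)
  qed
  moreover have "f (x \<beta>) \<in> Field Q" if "\<beta> \<le> \<alpha>" for \<beta>
    using xF[OF that] f by (auto simp: continuous_map_def topspace_scott)
  ultimately show ?thesis
    unfolding alternating_chain_def decreasing_chain_def using H le by auto
qed

lemma wadge_hard_alternating_chain:
  assumes P: "Partial_order P" and Q: "Partial_order Q" and x: "decreasing_chain P \<alpha> x"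
    and hard: "wadge_hard P Q H (diff_class \<alpha> P)"
  shows "\<exists>y. alternating_chain Q H \<alpha> y"
proof -
  have "\<exists>\<sigma>. \<beta> < \<alpha> \<longrightarrow> imm_succ \<beta> \<sigma> \<and> \<sigma> \<le> \<alpha>" for \<beta> using imm_succ_exists[of \<beta> \<alpha>] by blast
  then obtain s where s: "\<And>\<beta>. \<beta> < \<alpha> \<Longrightarrow> imm_succ \<beta> (s \<beta>)" "\<And>\<beta>. \<beta> < \<alpha> \<Longrightarrow> s \<beta> \<le> \<alpha>" by metis
  \<comment> \<open>For \<gamma> \<le> \<alpha>, \<open>x \<gamma>\<close> lies in
    \<open>A \<beta>\<close> exactly if \<gamma> \<le> \<beta>. So \<open>x \<beta>\<close> gets
    rank \<beta>, with \<open>x \<alpha>\<close> receiving the default.\<close>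
  define A where "A \<beta> = {z \<in> Field P. (z, x (s \<beta>)) \<notin> P}" for \<beta>
  have xF: "x \<beta> \<in> Field P" if "\<beta> \<le> \<alpha>" for \<beta> using x that by (simp add: decreasing_chain_def)
  have "openin (scott P) (A \<beta>)" if "\<beta> < \<alpha>" for \<beta>
    unfolding openin_scott A_def by (intro scott_open_not_below[OF P] xF s that)
  then have "diff_set \<alpha> A \<in> diff_class \<alpha> P" by (auto simp: diff_class_def)
  then obtain f where f: "continuous_map (scott P) (scott Q) f" "diff_set \<alpha> A = {z \<in> Field P. f z \<in> H}"
    using hard unfolding wadge_hard_def by blast
  have "rank \<alpha> A (x \<beta>) = \<beta>" if b: "\<beta> \<le> \<alpha>" for \<beta>
  proof (rule rank_eqI[OF b])
    assume "\<beta> < \<alpha>"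
    moreover have "\<beta> < s \<beta>" using s(1)[OF \<open>\<beta> < \<alpha>\<close>] by (simp add: imm_succ_def)
    ultimately have "(x (s \<beta>), x \<beta>) \<in> P" "x (s \<beta>) \<noteq> x \<beta>"
      using x s(2) unfolding decreasing_chain_def by auto
    then show "x \<beta> \<in> A \<beta>" using po_antisym[OF P] xF[OF b] by (auto simp: A_def)
  next
    fix \<gamma> assume "\<gamma> < \<beta>"
    then have "s \<gamma> \<le> \<beta>" using imm_succ_le_iff s(1) b by (metis less_le_trans)
    then show "x \<beta> \<notin> A \<gamma>" using decreasing_chain_le[OF P x _ b] by (auto simp: A_def)
  qed
  then show ?thesis
    using alternating_chain_image[OF P Q f(1) x _ f(2)] by (auto simp: same_parity_def)
qed

text \<open>Above the last limit ordinal \<open>\<lambda> \<le> \<alpha>\<close> there are only finitely many ordinals, so there the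
  separation of \<open>x \<beta>\<close> from its successor \<open>x (\<beta> + 1)\<close> is a finite amount of information. Below
  \<open>\<lambda>\<close> the successor is not computable from \<open>R\<close>; separating instead \<open>x \<gamma>\<close> from \<open>x \<delta>\<close> for all
  \<open>\<gamma> < \<delta> < \<beta>\<close> is uniformly c.e. and shifts the rank of \<open>x \<gamma>\<close> from \<open>\<gamma>\<close> to \<open>\<gamma> + 2\<close>,
  which has the same parity.\<close>

lemma eff_diff_class_separating:
  fixes \<alpha> :: "'i::wellorder"
  assumes pres: "presentation P p" and R: "computable_copy R \<rho> {..\<alpha>}"
    and x: "decreasing_chain P \<alpha> x" and C: "computable_rel (chain_rel P p R \<rho> x)"
  shows "\<exists>A. diff_set \<alpha> A \<in> eff_diff_class R \<rho> \<alpha> (basic_open P p) \<and>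
    (\<forall>\<beta>\<le>\<alpha>. same_parity (rank \<alpha> A (x \<beta>)) \<beta>)"
proof -
  note P = presentation_po[OF pres]
  have basis: "domain_basis P (range p)" using pres by (simp add: presentation_def)
  have xF: "x \<beta> \<in> Field P" if "\<beta> \<le> \<alpha>" for \<beta> using x that by (simp add: decreasing_chain_def)
  have "\<exists>\<sigma>. \<beta> < \<alpha> \<longrightarrow> imm_succ \<beta> \<sigma> \<and> \<sigma> \<le> \<alpha>" for \<beta> using imm_succ_exists[of \<beta> \<alpha>] by blast
  then obtain s where s: "\<And>\<beta>. \<beta> < \<alpha> \<Longrightarrow> imm_succ \<beta> (s \<beta>)" "\<And>\<beta>. \<beta> < \<alpha> \<Longrightarrow> s \<beta> \<le> \<alpha>" by metis
  have sless: "\<beta> < s \<beta>" if "\<beta> < \<alpha>" for \<beta> using s(1)[OF that] by (simp add: imm_succ_def)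
  \<comment> \<open>This is the \<lambda> described before the lemma, or the least element if there
    is no limit up to \<alpha>. The candidate \<alpha> shows that the minimum exists.\<close>
  define l where "l = (LEAST l. finite {l..\<alpha>})"
  have fin: "finite {l..\<alpha>}" unfolding l_def by (rule LeastI[of _ \<alpha>]) simp
  have l\<alpha>: "l \<le> \<alpha>" unfolding l_def by (rule Least_le) simp
  have slim: "s \<beta> < l" if "\<beta> < l" for \<beta>
  proof (rule ccontr)
    assume n: "\<not> s \<beta> < l"
    have "\<beta> < \<alpha>" using that l\<alpha> by simp
    \<comment> \<open>If \<open>l \<le> s \<beta>\<close>, prepending the single point \<beta> gives
      a longer finite final segment, against the minimality of \<open>l\<close>.\<close>
    have "l \<le> \<gamma>" if "\<beta> < \<gamma>" for \<gamma>
      using n that imm_succ_le_iff[OF s(1)[OF \<open>\<beta> < \<alpha>\<close>], of \<gamma>] by simp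
    then have "{\<beta>..\<alpha>} \<subseteq> insert \<beta> {l..\<alpha>}" by (auto simp: order.order_iff_strict)
    then have "finite {\<beta>..\<alpha>}" using fin by (auto intro: finite_subset)
    then have "l \<le> \<beta>" unfolding l_def by (rule Least_le)
    then show False using that by simp
  qed
  define N where "N = inv_into (Field R) \<rho>"
  have N: "N \<beta> \<in> Field R" "\<rho> (N \<beta>) = \<beta>" if "\<beta> \<le> \<alpha>" for \<beta>
    using computable_copy_inv[OF R] that by (auto simp: N_def)
  have N\<rho>: "N (\<rho> n) = n" if "n \<in> Field R" for n
    using R that by (auto simp: N_def computable_copy_def bij_betw_def)
  have Rc: "computable_rel R" using R by (simp add: computable_copy_def)
  have Rle: "(m, n) \<in> R \<longleftrightarrow> \<rho> m \<le> \<rho> n" if "m \<in> Field R" "n \<in> Field R" for m n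
    using R that by (auto simp: computable_copy_def)
  have FR: "n \<in> Field R \<longleftrightarrow> (n, n) \<in> R" for n using Rle by (auto intro: FieldI1)
  have Rlt: "(m, n) \<in> R - Id \<longleftrightarrow> m \<in> Field R \<and> n \<in> Field R \<and> \<rho> m < \<rho> n" for m n
  proof -
    have "\<rho> m = \<rho> n \<longleftrightarrow> m = n" if "m \<in> Field R" "n \<in> Field R" using N\<rho> that by metis
    then show ?thesis using Rle by (auto simp: less_le intro: FieldI1 FieldI2)
  qed
  define C' where "C' = chain_rel P p R \<rho> x"
  have C': "(n, i) \<in> C' \<longleftrightarrow> n \<in> Field R \<and> way_below P (p i) (x (\<rho> n))" for n i
    by (simp add: C'_def chain_rel_def)
  have C'c: "computable_rel C'" using C by (simp add: C'_def)
  define L where "L = R - Id"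
  \<comment> \<open>\<open>E\<close> holds \<open>(b, i)\<close> if \<open>p i\<close> approximates
    some chain member with index before \<open>\<rho> b\<close> but not \<open>x (\<rho> b)\<close>
    itself. In \<open>W\<close>, the row of a code outside \<open>T\<close> collects the rows of
    \<open>E\<close> at codes of smaller ordinals; the finitely many rows in \<open>T\<close> have
    the code of the successor built in as a constant. Deciding non-approximation is where
    computability of the chain enters.\<close>
  define E where "E = L\<inverse> O C' \<inter> {(b, i). (b, b) \<in> R \<and> (b, i) \<notin> C'}"
  define T where "T = N ` {l..<\<alpha>}"
  define W where "W = L\<inverse> O E \<inter> {(m, i). \<forall>t\<in>T. m \<noteq> t} \<union>
    (\<Union>t\<in>T. {(m, i). m = t \<and> (t, i) \<in> C' \<and> (N (s (\<rho> t)), i) \<notin> C'})"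
  have Tfin: "finite T" unfolding T_def
    by (intro finite_imageI finite_subset[OF _ fin]) auto
  have Tmem: "n \<in> T \<longleftrightarrow> l \<le> \<rho> n \<and> \<rho> n < \<alpha>" if "n \<in> Field R" for n
    unfolding T_def using N N\<rho>[OF that] by (force simp: image_iff)
  have "computable_rel {(a, b). (a, b) \<in> R \<and> a \<noteq> b}"
    by (intro computable_relI decidable_conj decidable_mem[OF Rc] decidable_not decidable_eq proj) auto
  moreover have "{(a, b). (a, b) \<in> R \<and> a \<noteq> b} = L" by (auto simp: L_def)
  ultimately have ceL: "ce_rel (L\<inverse>)" by (intro ce_rel_converse ce_rel_computable) simp
  have "computable_rel {(b, i). (b, b) \<in> R \<and> (b, i) \<notin> C'}"
    by (intro computable_relI decidable_conj decidable_mem[OF Rc] decidable_mem[OF C'c]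
        decidable_not proj) auto
  then have ceE: "ce_rel E"
    unfolding E_def by (intro ce_rel_Int_computable ce_rel_relcomp ceL ce_rel_computable C'c)
  have "decidable 2 (\<lambda>xs. \<forall>t\<in>T. xs ! 0 \<noteq> t)"
    using Tfin
  proof (induction T rule: finite_induct)
    case empty
    show ?case unfolding decidable_def by (simp add: recursive_const[simplified])
  next
    case (insert t F)
    have "decidable 2 (\<lambda>xs. xs ! 0 \<noteq> t \<and> (\<forall>t\<in>F. xs ! 0 \<noteq> t))"
      by (intro decidable_conj decidable_not decidable_eq proj recursive_const insert.IH) simp
    then show ?case by simp
  qed
  then have "ce_rel W"
    unfolding W_def
    by (intro ce_rel_Un ce_rel_Int_computable ce_rel_relcomp ceL ceE ce_rel_UN_finite Tfin
        ce_rel_computable computable_relI decidable_conj decidable_mem[OF C'c] decidable_not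
        decidable_eq proj recursive_const) auto
  define A where "A \<beta> = (\<Union>i\<in>{i. (N \<beta>, i) \<in> W}. basic_open P p i)" for \<beta>
  have "diff_set \<alpha> A \<in> eff_diff_class R \<rho> \<alpha> (basic_open P p)"
    unfolding eff_diff_class_def
    using \<open>ce_rel W\<close> by (intro CollectI exI[of _ A] conjI refl exI[of _ W]) (auto simp: A_def N\<rho>)
  moreover have "same_parity (rank \<alpha> A (x \<epsilon>)) \<epsilon>" if \<epsilon>: "\<epsilon> \<le> \<alpha>" for \<epsilon>
  proof -
    have above: "\<epsilon> < \<delta>" if "\<delta> \<le> \<alpha>" "way_below P (p i) (x \<epsilon>)" "\<not> way_below P (p i) (x \<delta>)" for i \<delta>
    proof (rule ccontr)
      assume "\<not> \<epsilon> < \<delta>"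
      then have "(x \<epsilon>, x \<delta>) \<in> P" using decreasing_chain_le[OF P x _ \<epsilon>] by simp
      then show False using that way_below_le_trans[OF P] by blast
    qed
    have sep: "\<exists>i. way_below P (p i) (x \<gamma>) \<and> \<not> way_below P (p i) (x \<delta>)"
      if "\<gamma> < \<delta>" "\<delta> \<le> \<alpha>" for \<gamma> \<delta>
    proof -
      have "(x \<delta>, x \<gamma>) \<in> P" "x \<delta> \<noteq> x \<gamma>" using x that unfolding decreasing_chain_def by auto
      then have "(x \<gamma>, x \<delta>) \<notin> P" using po_antisym[OF P] by blast
      then show ?thesis using basis_separates[OF basis xF xF _ P, of \<gamma> \<delta>] that by auto
    qed
    \<comment> \<open>An index that fails at \<open>x \<delta>\<close> and approximates
      \<open>x \<epsilon>\<close> forces \<epsilon> < \<delta>, whichever \<gamma> put it in the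
      row; conversely take \<gamma> = \<epsilon>. So \<open>x \<epsilon>\<close> enters two steps
      late.\<close>
    have low: "x \<epsilon> \<in> A \<beta> \<longleftrightarrow> (\<exists>\<delta>. \<epsilon> < \<delta> \<and> \<delta> < \<beta>)" if \<beta>: "\<beta> < l" for \<beta>
    proof -
      have \<beta>\<alpha>: "\<beta> \<le> \<alpha>" using \<beta> l\<alpha> by simp
      have "N \<beta> \<notin> T" using Tmem[OF N(1)[OF \<beta>\<alpha>]] N(2)[OF \<beta>\<alpha>] \<beta> by auto
      then have W: "(N \<beta>, i) \<in> W \<longleftrightarrow> (\<exists>\<gamma> \<delta>. \<gamma> < \<delta> \<and> \<delta> < \<beta> \<and> way_below P (p i) (x \<gamma>) \<and>
          \<not> way_below P (p i) (x \<delta>))" (is "_ \<longleftrightarrow> ?B") for i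
      proof -
        have "(N \<beta>, i) \<in> W \<longleftrightarrow> (\<exists>b a. (b, N \<beta>) \<in> L \<and> (a, b) \<in> L \<and> (a, i) \<in> C' \<and> (b, b) \<in> R \<and> (b, i) \<notin> C')"
          using \<open>N \<beta> \<notin> T\<close> by (auto simp: W_def E_def)
        also have "\<dots> \<longleftrightarrow> ?B"
        proof
          assume "\<exists>b a. (b, N \<beta>) \<in> L \<and> (a, b) \<in> L \<and> (a, i) \<in> C' \<and> (b, b) \<in> R \<and> (b, i) \<notin> C'"
          then obtain a b where "(b, N \<beta>) \<in> L" "(a, b) \<in> L" "(a, i) \<in> C'" "(b, i) \<notin> C'" by blast
          then show ?B using N(2)[OF \<beta>\<alpha>] by (auto simp: L_def Rlt[simplified] C')
        next
          assume ?B
          then obtain \<gamma> \<delta> where gd: "\<gamma> < \<delta>" "\<delta> < \<beta>" "way_below P (p i) (x \<gamma>)"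
            "\<not> way_below P (p i) (x \<delta>)" by blast
          moreover have "\<gamma> \<le> \<alpha>" "\<delta> \<le> \<alpha>" using gd \<beta>\<alpha> by auto
          ultimately have "(N \<delta>, N \<beta>) \<in> L \<and> (N \<gamma>, N \<delta>) \<in> L \<and> (N \<gamma>, i) \<in> C' \<and> (N \<delta>, N \<delta>) \<in> R \<and>
              (N \<delta>, i) \<notin> C'"
            unfolding L_def Rlt using N \<beta>\<alpha> by (auto simp: C' FR[symmetric])
          then show "\<exists>b a. (b, N \<beta>) \<in> L \<and> (a, b) \<in> L \<and> (a, i) \<in> C' \<and> (b, b) \<in> R \<and> (b, i) \<notin> C'"
            by blast
        qed
        finally show ?thesis .
      qed
      show ?thesis
      proof
        assume "x \<epsilon> \<in> A \<beta>"
        then obtain i \<gamma> \<delta> where "\<delta> < \<beta>" "way_below P (p i) (x \<epsilon>)" "\<not> way_below P (p i) (x \<delta>)"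
          by (auto simp: A_def W basic_open_def)
        moreover have "\<delta> \<le> \<alpha>" using \<open>\<delta> < \<beta>\<close> \<beta>\<alpha> by simp
        ultimately show "\<exists>\<delta>. \<epsilon> < \<delta> \<and> \<delta> < \<beta>" using above[of \<delta> i] by blast
      next
        assume "\<exists>\<delta>. \<epsilon> < \<delta> \<and> \<delta> < \<beta>"
        then obtain \<delta> where d: "\<epsilon> < \<delta>" "\<delta> < \<beta>" by blast
        moreover have "\<delta> \<le> \<alpha>" using d \<beta>\<alpha> by simp
        ultimately obtain i where "way_below P (p i) (x \<epsilon>)" "\<not> way_below P (p i) (x \<delta>)"
          using sep[of \<epsilon> \<delta>] by blast
        then show "x \<epsilon> \<in> A \<beta>" using d by (auto simp: A_def W basic_open_def)
      qed
    qed
    \<comment> \<open>Here the row separates \<open>x \<beta>\<close> from its successor, so there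
      is no shift.\<close>
    have high: "x \<epsilon> \<in> A \<beta> \<longleftrightarrow> \<epsilon> \<le> \<beta>" if \<beta>: "l \<le> \<beta>" "\<beta> < \<alpha>" for \<beta>
    proof -
      have \<beta>\<alpha>: "\<beta> \<le> \<alpha>" using \<beta> by simp
      have "N \<beta> \<in> T" using \<beta> by (simp add: T_def)
      then have W: "(N \<beta>, i) \<in> W \<longleftrightarrow> way_below P (p i) (x \<beta>) \<and> \<not> way_below P (p i) (x (s \<beta>))" for i
        using N[OF \<beta>\<alpha>] N[OF s(2)[OF \<beta>(2)]] by (auto simp: W_def C')
      show ?thesis
      proof
        assume "x \<epsilon> \<in> A \<beta>"
        then obtain i where "way_below P (p i) (x \<epsilon>)" "\<not> way_below P (p i) (x (s \<beta>))"
          by (auto simp: A_def W basic_open_def)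
        then have "\<epsilon> < s \<beta>" using above s(2)[OF \<beta>(2)] by blast
        then show "\<epsilon> \<le> \<beta>" using imm_succ_le_iff[OF s(1)[OF \<beta>(2)], of \<epsilon>] by auto
      next
        assume le: "\<epsilon> \<le> \<beta>"
        obtain i where "way_below P (p i) (x \<beta>)" "\<not> way_below P (p i) (x (s \<beta>))"
          using sep[OF sless s(2)] \<beta>(2) by blast
        moreover have "way_below P (p i) (x \<epsilon>)"
          using calculation(1) way_below_le_trans[OF P] decreasing_chain_le[OF P x le \<beta>\<alpha>] by blast
        ultimately show "x \<epsilon> \<in> A \<beta>" by (auto simp: A_def W basic_open_def)
      qed
    qed
    show ?thesis
    proof (cases "\<epsilon> < l")
      case True
      \<comment> \<open>Two successor steps stay below \<open>l\<close>, so the shifted rank is a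
        proper index, not the default \<alpha>, and \<open>low\<close> applies to it.\<close>
      have lt: "\<epsilon> < \<alpha>" "s \<epsilon> < \<alpha>" "s (s \<epsilon>) < l" using True slim l\<alpha> by (auto intro: less_le_trans)
      have is1: "imm_succ \<epsilon> (s \<epsilon>)" and is2: "imm_succ (s \<epsilon>) (s (s \<epsilon>))" using s lt by auto
      have "rank \<alpha> A (x \<epsilon>) = s (s \<epsilon>)"
      proof (rule rank_eqI)
        show "s (s \<epsilon>) \<le> \<alpha>" using lt l\<alpha> by simp
        show "x \<epsilon> \<in> A (s (s \<epsilon>))" using low[OF lt(3)] sless lt by blast
        fix \<beta> assume b: "\<beta> < s (s \<epsilon>)"
        have "\<not> (\<epsilon> < \<delta> \<and> \<delta> < \<beta>)" for \<delta>
          using imm_succ_le_iff[OF is1, of \<delta>] imm_succ_le_iff[OF is2, of \<beta>] b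
          by (meson le_less_trans leD)
        moreover have "\<beta> < l" using b lt by simp
        ultimately show "x \<epsilon> \<notin> A \<beta>" using low by blast
      qed
      then show ?thesis
        using even_ord_imm_succ[OF is1] even_ord_imm_succ[OF is2] by (simp add: same_parity_def)
    next
      case False
      \<comment> \<open>In the finite tail, the sets with index below \<open>l\<close> contribute
        nothing: no \<delta> is above \<epsilon> and below a \<beta> < \<epsilon>.\<close>
      have "rank \<alpha> A (x \<epsilon>) = \<epsilon>"
      proof (rule rank_eqI[OF \<epsilon>])
        show "x \<epsilon> \<in> A \<epsilon>" if "\<epsilon> < \<alpha>" using high[of \<epsilon>] that False by simp
        fix \<beta> assume "\<beta> < \<epsilon>"
        then show "x \<epsilon> \<notin> A \<beta>"
        proof (cases "\<beta> < l")
          case True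
          have "\<not> (\<epsilon> < \<delta> \<and> \<delta> < \<beta>)" for \<delta> using \<open>\<beta> < \<epsilon>\<close> by auto
          then show ?thesis using low[OF True] by blast
        next
          case False
          have "\<beta> < \<alpha>" using \<open>\<beta> < \<epsilon>\<close> \<epsilon> by simp
          then show ?thesis using high[of \<beta>] False \<open>\<beta> < \<epsilon>\<close> by simp
        qed
      qed
      then show ?thesis by (simp add: same_parity_def)
    qed
  qed
  ultimately show ?thesis by blast
qed

text \<open>A basic open set contains \<open>f (x \<beta>)\<close> exactly if the witness
  \<open>W\<close> pairs it with an index that approximates \<open>x \<beta>\<close>. So the
  approximation relation of the image chain is that of \<open>x\<close> composed with
  \<open>W\<close>, over the same copy of \<alpha> + 1.\<close>

lemma eff_wadge_hard_alternating_chain: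
  assumes P: "presentation P p" and Q: "Partial_order Q" and R: "computable_copy R \<rho> {..\<alpha>}"
    and x: "decreasing_chain P \<alpha> x" and C: "computable_rel (chain_rel P p R \<rho> x)"
    and hard: "eff_wadge_hard P p Q q H (eff_diff_class R \<rho> \<alpha> (basic_open P p))"
  shows "\<exists>y. alternating_chain Q H \<alpha> y \<and> effective_seq Q q \<alpha> y"
proof -
  obtain A where A: "diff_set \<alpha> A \<in> eff_diff_class R \<rho> \<alpha> (basic_open P p)"
    and rk: "\<And>\<beta>. \<beta> \<le> \<alpha> \<Longrightarrow> same_parity (rank \<alpha> A (x \<beta>)) \<beta>"
    using eff_diff_class_separating[OF P R x C] by blast
  obtain f where f: "effective_map P (basic_open P p) Q (basic_open Q q) f"
    and X: "diff_set \<alpha> A = {z \<in> Field P. f z \<in> H}"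
    using hard A unfolding eff_wadge_hard_def by blast
  obtain W where W: "ce_rel W"
    and pre: "\<And>j. {z \<in> Field P. f z \<in> basic_open Q q j} = (\<Union>i\<in>{i. (i, j) \<in> W}. basic_open P p i)"
    using f unfolding effective_map_def by blast
  have "alternating_chain Q H \<alpha> (\<lambda>\<beta>. f (x \<beta>))"
    using f by (intro alternating_chain_image[OF presentation_po[OF P] Q _ x rk X])
      (simp_all add: effective_map_def)
  moreover have "chain_rel Q q R \<rho> (\<lambda>\<beta>. f (x \<beta>)) = chain_rel P p R \<rho> x O W"
  proof -
    have "way_below Q (q j) (f (x (\<rho> n))) \<longleftrightarrow> (\<exists>i. way_below P (p i) (x (\<rho> n)) \<and> (i, j) \<in> W)"
      if "n \<in> Field R" for n j
    proof -
      have "\<rho> n \<le> \<alpha>" using R that by (auto simp: computable_copy_def bij_betw_def)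
      then have "x (\<rho> n) \<in> Field P" using x by (simp add: decreasing_chain_def)
      then show ?thesis using pre[of j] by (auto simp: basic_open_def set_eq_iff)
    qed
    then show ?thesis by (auto simp: chain_rel_def)
  qed
  ultimately show ?thesis
    using R ce_rel_relcomp[OF ce_rel_computable[OF C] W] unfolding effective_seq_def by metis
qed

section \<open>Copies of the domain of sets of natural numbers\<close>

text \<open>The domain is transported along an injection: the identity gives \<open>pow_nat\<close>,
  and \<open>Inr\<close> a copy inside the type over which the theorem quantifies.\<close>

definition pow_copy :: "(nat set \<Rightarrow> 'a) \<Rightarrow> 'a rel" where
  "pow_copy e = {(e A, e B) |A B. A \<subseteq> B}"

lemma pow_copy_id: "pow_copy (\<lambda>A. A) = pow_nat"
  by (auto simp: pow_copy_def pow_nat_def)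

lemma Field_pow_copy: "Field (pow_copy e) = range e"
  unfolding pow_copy_def Field_def by blast

context
  fixes e :: "nat set \<Rightarrow> 'a"
  assumes e: "inj e"
begin

lemma pow_copy_iff: "(e A, e B) \<in> pow_copy e \<longleftrightarrow> A \<subseteq> B"
  using e by (auto simp: pow_copy_def inj_eq)

lemma pow_copy_po: "Partial_order (pow_copy e)"
proof -
  have "refl_on (Field (pow_copy e)) (pow_copy e)"
    by (auto simp: refl_on_def Field_pow_copy pow_copy_iff)
  moreover have "trans (pow_copy e)"
    by (rule transI) (use e in \<open>auto simp: pow_copy_def inj_eq\<close>)
  moreover have "antisym (pow_copy e)"
    by (rule antisymI) (use e in \<open>auto simp: pow_copy_def inj_eq\<close>)
  ultimately show ?thesis
    by (auto simp: partial_order_on_def preorder_on_def Field_def)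
qed

section \<open>Suprema and approximation by finite subsets\<close>

lemma is_sup_pow_copy: "is_sup (pow_copy e) (e ` \<D>) (e (\<Union>\<D>))"
  by (auto simp: is_sup_def Field_pow_copy pow_copy_iff)

lemma is_sup_pow_copy_eq: "is_sup (pow_copy e) (e ` \<D>) s \<Longrightarrow> s = e (\<Union>\<D>)"
  using is_sup_pow_copy[of \<D>] unfolding is_sup_def by (intro po_antisym[OF pow_copy_po]) blast+

lemma directed_finite_subsets: "directed (pow_copy e) (e ` {F. finite F \<and> F \<subseteq> B})"
  unfolding directed_def
proof (intro conjI ballI)
  fix y z assume "y \<in> e ` {F. finite F \<and> F \<subseteq> B}" "z \<in> e ` {F. finite F \<and> F \<subseteq> B}"
  then obtain F G where "y = e F" "z = e G" "finite (F \<union> G)" "F \<union> G \<subseteq> B" by auto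
  then show "\<exists>w\<in>e ` {F. finite F \<and> F \<subseteq> B}. (y, w) \<in> pow_copy e \<and> (z, w) \<in> pow_copy e"
    by (intro bexI[of _ "e (F \<union> G)"]) (auto simp: pow_copy_iff)
qed (auto simp: Field_pow_copy)

lemma is_sup_finite_subsets: "is_sup (pow_copy e) (e ` {F. finite F \<and> F \<subseteq> B}) (e B)"
proof -
  have "\<Union>{F. finite F \<and> F \<subseteq> B} = B" by (auto intro!: exI[of _ "{_}"])
  then show ?thesis using is_sup_pow_copy[of "{F. finite F \<and> F \<subseteq> B}"] by simp
qed

text \<open>\<open>B\<close> is the directed supremum of its finite subsets, so anything
  approximating it is inside one of them. Conversely, a finite set covered by a directed union lies
  in a single member, by adding one point at a time.\<close>

lemma way_below_pow_copy: "way_below (pow_copy e) (e A) (e B) \<longleftrightarrow> finite A \<and> A \<subseteq> B"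
proof
  assume "way_below (pow_copy e) (e A) (e B)"
  moreover have "(e B, e B) \<in> pow_copy e" by (simp add: pow_copy_iff)
  ultimately obtain F where "finite F" "F \<subseteq> B" "(e A, e F) \<in> pow_copy e"
    using directed_finite_subsets is_sup_finite_subsets unfolding way_below_def by blast
  then show "finite A \<and> A \<subseteq> B" by (auto simp: pow_copy_iff intro: finite_subset)
next
  assume AB: "finite A \<and> A \<subseteq> B"
  show "way_below (pow_copy e) (e A) (e B)"
    unfolding way_below_def
  proof (intro conjI allI impI)
    fix D s assume D: "directed (pow_copy e) D \<and> is_sup (pow_copy e) D s \<and> (e B, s) \<in> pow_copy e"
    then obtain \<D> where \<D>: "D = e ` \<D>"
      by (auto simp: directed_def Field_pow_copy subset_image_iff)
    then have "s = e (\<Union>\<D>)" using D is_sup_pow_copy_eq by blast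
    then have "A \<subseteq> \<Union>\<D>" using AB D by (auto simp: pow_copy_iff)
    have "\<exists>d\<in>\<D>. A \<subseteq> d" using conjunct1[OF AB] \<open>A \<subseteq> \<Union>\<D>\<close>
    proof (induction A rule: finite_induct)
      case empty
      then show ?case using D \<D> by (auto simp: directed_def)
    next
      case (insert a F)
      then obtain d d' where d: "d \<in> \<D>" "F \<subseteq> d" "d' \<in> \<D>" "a \<in> d'" by auto
      then obtain c where "c \<in> \<D>" "(e d, e c) \<in> pow_copy e" "(e d', e c) \<in> pow_copy e"
        using D unfolding \<D> directed_def by blast
      then show ?case using d by (intro bexI[of _ c]) (auto simp: pow_copy_iff)
    qed
    then show "\<exists>d\<in>D. (e A, d) \<in> pow_copy e" by (auto simp: \<D> pow_copy_iff)
  qed (auto simp: Field_pow_copy)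
qed

text \<open>The elements of \<open>B\<close> that approximate \<open>e A\<close> are always the
  images of the finite subsets of \<open>A\<close>. This covers at once the set of all points, the
  compact points and the canonical enumeration.\<close>

lemma domain_basis_pow_copy:
  assumes "B \<subseteq> range e" "\<And>F. finite F \<Longrightarrow> e F \<in> B"
  shows "domain_basis (pow_copy e) B"
proof -
  have eq: "{b \<in> B. way_below (pow_copy e) b (e A)} = e ` {F. finite F \<and> F \<subseteq> A}" for A
  proof (intro subset_antisym subsetI)
    fix b assume b: "b \<in> {b \<in> B. way_below (pow_copy e) b (e A)}"
    then obtain F where "b = e F" using assms(1) by auto
    then show "b \<in> e ` {F. finite F \<and> F \<subseteq> A}" using b by (simp add: way_below_pow_copy)
  next
    fix b assume "b \<in> e ` {F. finite F \<and> F \<subseteq> A}"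
    then show "b \<in> {b \<in> B. way_below (pow_copy e) b (e A)}"
      using assms(2) by (auto simp: way_below_pow_copy)
  qed
  show ?thesis
    unfolding domain_basis_def Field_pow_copy
  proof (intro conjI ballI assms(1))
    fix x assume "x \<in> range e"
    then obtain A where x: "x = e A" ..
    show "directed (pow_copy e) {b \<in> B. way_below (pow_copy e) b x}"
      "is_sup (pow_copy e) {b \<in> B. way_below (pow_copy e) b x} x"
      unfolding x eq by (rule directed_finite_subsets, rule is_sup_finite_subsets)
  qed
qed

lemma dcpo_pow_copy: "dcpo (pow_copy e)"
  unfolding dcpo_def
proof (intro conjI allI impI pow_copy_po)
  fix D assume "directed (pow_copy e) D"
  then obtain \<D> where "D = e ` \<D>" by (auto simp: directed_def Field_pow_copy subset_image_iff)
  then show "\<exists>s. is_sup (pow_copy e) D s" using is_sup_pow_copy by blast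
qed

lemma continuous_domain_pow_copy: "continuous_domain (pow_copy e)"
  unfolding continuous_domain_def Field_pow_copy
  by (intro conjI dcpo_pow_copy domain_basis_pow_copy) auto

lemma algebraic_domain_pow_copy: "algebraic_domain (pow_copy e)"
proof -
  have "{x. way_below (pow_copy e) x x} \<subseteq> Field (pow_copy e)" by (auto simp: way_below_def)
  then have "domain_basis (pow_copy e) {x. way_below (pow_copy e) x x}"
    by (intro domain_basis_pow_copy) (auto simp: Field_pow_copy way_below_pow_copy)
  then show ?thesis by (simp add: algebraic_domain_def dcpo_pow_copy)
qed

lemma effective_presentation_pow_copy: "effective_presentation (pow_copy e) (\<lambda>n. e (set_decode n))"
proof -
  have "domain_basis (pow_copy e) (range (\<lambda>n. e (set_decode n)))"
  proof (rule domain_basis_pow_copy)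
    fix F :: "nat set" assume "finite F"
    then have "e F = e (set_decode (set_encode F))" by simp
    then show "e F \<in> range (\<lambda>n. e (set_decode n))" by (rule range_eqI)
  qed auto
  \<comment> \<open>Inclusion becomes a quantifier bounded by the code, hence decidable.\<close>
  moreover have "{(i, j). way_below (pow_copy e) (e (set_decode i)) (e (set_decode j))} =
      {(i, j). \<forall>m<i. m \<in> set_decode i \<longrightarrow> m \<in> set_decode j}"
    using set_decode_less by (auto simp: way_below_pow_copy)
  moreover have "computable_rel {(i, j). \<forall>m<i. m \<in> set_decode i \<longrightarrow> m \<in> set_decode j}"
  proof (rule computable_relI)
    let ?A = "\<lambda>ys. ys ! 0 \<in> set_decode (ys ! 1) \<longrightarrow> ys ! 0 \<in> set_decode (ys ! 2)"
    have "decidable (Suc 2) ?A"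
      by (intro decidable_imp decidable_set_decode proj) auto
    from decidable_bounded_all[OF this, of 0] show "decidable 2 (\<lambda>xs. \<forall>m<xs ! 0. m \<in> set_decode (xs ! 0) \<longrightarrow> m \<in> set_decode (xs ! 1))"
      by simp
  qed
  ultimately show ?thesis
    using continuous_domain_pow_copy
    by (simp add: effective_presentation_def presentation_def ce_rel_computable)
qed

text \<open>Tails shrink as the index grows, and \<open>c \<delta>\<close> belongs to the tail of
  \<beta> but no longer to that of \<delta>. The last member is the empty set.\<close>

lemma decreasing_chain_tails:
  assumes "inj_on c {..\<alpha>}"
  shows "decreasing_chain (pow_copy e) \<alpha> (\<lambda>\<beta>. e (c ` {\<beta><..\<alpha>}))"
  unfolding decreasing_chain_def
proof (intro conjI allI impI)
  fix \<beta> \<delta> assume bd: "\<beta> < \<delta> \<and> \<delta> \<le> \<alpha>"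
  then show "(e (c ` {\<delta><..\<alpha>}), e (c ` {\<beta><..\<alpha>})) \<in> pow_copy e"
    unfolding pow_copy_iff by (intro image_mono) auto
  have "c \<delta> \<in> c ` {\<beta><..\<alpha>}" using bd by auto
  moreover have "c \<delta> \<notin> c ` {\<delta><..\<alpha>}"
    using inj_on_image_mem_iff[OF assms, of \<delta> "{\<delta><..\<alpha>}"] bd by (simp add: subset_iff)
  ultimately have "c ` {\<delta><..\<alpha>} \<noteq> c ` {\<beta><..\<alpha>}" by blast
  then show "e (c ` {\<delta><..\<alpha>}) \<noteq> e (c ` {\<beta><..\<alpha>})" by (simp add: inj_eq[OF e])
qed (simp add: Field_pow_copy)

lemma decreasing_chain_pow_copy:
  assumes "countable {..<\<alpha>}" shows "\<exists>x. decreasing_chain (pow_copy e) \<alpha> x"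
proof -
  have "{..\<alpha>} = insert \<alpha> {..<\<alpha>}" by auto
  then have "countable {..\<alpha>}" using assms by simp
  then obtain c :: "_ \<Rightarrow> nat" where "inj_on c {..\<alpha>}" by (rule countableE)
  then show ?thesis by (intro exI[of _ "\<lambda>\<beta>. e (c ` {\<beta><..\<alpha>})"] decreasing_chain_tails)
qed

text \<open>Code the ordinals by their own names in \<open>R\<close>. The tail after
  \<open>\<rho> n\<close> is then the set of numbers strictly above \<open>n\<close> in
  \<open>R\<close>, and whether it includes a canonical finite set is decided from
  \<open>R\<close>.\<close>

lemma computable_chain_pow_copy:
  assumes R: "computable_copy R \<rho> {..\<alpha>}"
  shows "\<exists>x. decreasing_chain (pow_copy e) \<alpha> x \<and>
    computable_rel (chain_rel (pow_copy e) (\<lambda>n. e (set_decode n)) R \<rho> x)"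
proof -
  define N where "N = inv_into (Field R) \<rho>"
  define x where "x \<beta> = e (N ` {\<beta><..\<alpha>})" for \<beta>
  have Rc: "computable_rel R" and bij: "bij_betw \<rho> (Field R) {..\<alpha>}"
    and Rle: "\<And>m n. m \<in> Field R \<Longrightarrow> n \<in> Field R \<Longrightarrow> (m, n) \<in> R \<longleftrightarrow> \<rho> m \<le> \<rho> n"
    using R by (auto simp: computable_copy_def)
  have "inj_on N {..\<alpha>}"
    using bij_betw_inv_into[OF bij] by (simp add: N_def bij_betw_def)
  then have "decreasing_chain (pow_copy e) \<alpha> x" unfolding x_def by (rule decreasing_chain_tails)
  moreover have tail: "N ` {\<rho> n<..\<alpha>} = {m. (n, m) \<in> R \<and> m \<noteq> n}" if n: "n \<in> Field R" for n
  proof (intro set_eqI iffI)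
    fix m assume "m \<in> N ` {\<rho> n<..\<alpha>}"
    then obtain \<beta> where b: "\<rho> n < \<beta>" "\<beta> \<le> \<alpha>" "m = N \<beta>" by auto
    then have "m \<in> Field R" "\<rho> m = \<beta>" using computable_copy_inv[OF R] by (auto simp: N_def)
    then show "m \<in> {m. (n, m) \<in> R \<and> m \<noteq> n}" using Rle n b by auto
  next
    fix m assume "m \<in> {m. (n, m) \<in> R \<and> m \<noteq> n}"
    then have m: "(n, m) \<in> R" "m \<noteq> n" "m \<in> Field R" by (auto intro: FieldI2)
    then have "\<rho> n \<le> \<rho> m" "\<rho> n \<noteq> \<rho> m" "\<rho> m \<le> \<alpha>"
      using Rle n bij inj_on_eq_iff[of \<rho> "Field R" n m] by (auto simp: bij_betw_def)
    then have "\<rho> n < \<rho> m" "\<rho> m \<le> \<alpha>" by auto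
    moreover have "N (\<rho> m) = m" using bij m by (auto simp: N_def bij_betw_def)
    ultimately show "m \<in> N ` {\<rho> n<..\<alpha>}" by (intro image_eqI[of _ _ "\<rho> m"]) auto
  qed
  have FR: "n \<in> Field R \<longleftrightarrow> (n, n) \<in> R" for n using Rle by (auto intro: FieldI1)
  have "chain_rel (pow_copy e) (\<lambda>n. e (set_decode n)) R \<rho> x =
      {(n, i). (n, n) \<in> R \<and> (\<forall>m<i. m \<in> set_decode i \<longrightarrow> (n, m) \<in> R \<and> m \<noteq> n)}"
    using set_decode_less by (auto simp: chain_rel_def x_def way_below_pow_copy tail FR[symmetric])
  moreover have "computable_rel {(n, i). (n, n) \<in> R \<and>
      (\<forall>m<i. m \<in> set_decode i \<longrightarrow> (n, m) \<in> R \<and> m \<noteq> n)}"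
  proof (rule computable_relI)
    let ?A = "\<lambda>ys. ys ! 0 \<in> set_decode (ys ! 2) \<longrightarrow> (ys ! 1, ys ! 0) \<in> R \<and> ys ! 0 \<noteq> ys ! 1"
    have A: "decidable (Suc 2) ?A"
      by (intro decidable_imp decidable_set_decode decidable_conj
          decidable_not decidable_eq decidable_mem[OF Rc] proj) auto
    have "decidable 2 (\<lambda>xs. (xs ! 0, xs ! 0) \<in> R)" by (intro decidable_mem[OF Rc] proj) auto
    from decidable_conj[OF this decidable_bounded_all[OF A, of 1]] show "decidable 2 (\<lambda>xs. (xs ! 0, xs ! 0) \<in> R \<and>
        (\<forall>m<xs ! 1. m \<in> set_decode (xs ! 1) \<longrightarrow> (xs ! 0, m) \<in> R \<and> m \<noteq> xs ! 0))"
      by simp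
  qed
  ultimately show ?thesis by (intro exI[of _ x]) simp
qed

end

section \<open>The characterization\<close>

theorem theorem4p8:
  fixes Q :: "'q rel" and H :: "'q set" and \<alpha> :: "'i::wellorder"
  assumes "continuous_domain Q" and "H \<subseteq> Field Q" and "countable {..<\<alpha>}"
  shows
    "(let
        i = (\<forall>P :: ('p + nat set) rel. continuous_domain P \<longrightarrow> wadge_hard P Q H (diff_class \<alpha> P));
        ii = wadge_hard pow_nat Q H (diff_class \<alpha> pow_nat);
        iii = (\<exists>P :: ('p + nat set) rel. continuous_domain P \<and> (\<exists>x. decreasing_chain P \<alpha> x) \<and>
                 wadge_hard P Q H (diff_class \<alpha> P));
        iv = (\<exists>x. alternating_chain Q H \<alpha> x)
      in (i \<longleftrightarrow> ii) \<and> (ii \<longleftrightarrow> iii) \<and> (iii \<longleftrightarrow> iv))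
     \<and>
     (\<forall>q. presentation Q q \<and> below_omega1_CK \<alpha> \<longrightarrow>
      (let
        i\<^sub>e = (\<exists>R \<rho>. computable_copy R \<rho> {..\<alpha>} \<and>
                (\<forall>(P :: ('p + nat set) rel) p. effective_presentation P p \<longrightarrow>
                   wadge_hard P Q H (diff_class \<alpha> P) \<and>
                   eff_wadge_hard P p Q q H (eff_diff_class R \<rho> \<alpha> (basic_open P p))));
        ii\<^sub>e = (\<exists>R \<rho>. computable_copy R \<rho> {..\<alpha>} \<and>
                eff_wadge_hard pow_nat set_decode Q q H
                  (eff_diff_class R \<rho> \<alpha> (basic_open pow_nat set_decode)));
        iii\<^sub>e = (\<exists>R \<rho>. computable_copy R \<rho> {..\<alpha>} \<and>
                (\<exists>(P :: ('p + nat set) rel) p. effective_presentation P p \<and> algebraic_domain P \<and>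
                   (\<exists>x. decreasing_chain P \<alpha> x \<and> computable_rel (chain_rel P p R \<rho> x)) \<and>
                   eff_wadge_hard P p Q q H (eff_diff_class R \<rho> \<alpha> (basic_open P p))));
        iv\<^sub>e = (\<exists>x. alternating_chain Q H \<alpha> x \<and> effective_seq Q q \<alpha> x)
      in (i\<^sub>e \<longleftrightarrow> ii\<^sub>e) \<and> (ii\<^sub>e \<longleftrightarrow> iii\<^sub>e) \<and> (iii\<^sub>e \<longleftrightarrow> iv\<^sub>e)))"
proof -
  \<comment> \<open>\<open>Inr\<close> yields the witness domain for the third conditions, the
    identity yields \<open>pow_nat\<close> for the second.\<close>
  have inj: "inj (Inr :: nat set \<Rightarrow> 'p + nat set)" "inj (\<lambda>A :: nat set. A)"
    by (auto intro: injI)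
  note Q = continuous_domain_po[OF assms(1)]
  note id = inj(2)[THEN pow_copy_po, unfolded pow_copy_id]
    inj(2)[THEN decreasing_chain_pow_copy, OF assms(3), unfolded pow_copy_id]
    inj(2)[THEN effective_presentation_pow_copy, unfolded pow_copy_id]
    inj(2)[THEN computable_chain_pow_copy, unfolded pow_copy_id]
  note cp = inj(1)[THEN continuous_domain_pow_copy] inj(1)[THEN decreasing_chain_pow_copy, OF assms(3)]
    inj(1)[THEN effective_presentation_pow_copy] inj(1)[THEN computable_chain_pow_copy]
    inj(1)[THEN algebraic_domain_pow_copy]
  note chain_hard = alternating_chain_wadge_hard[OF Q]
  have hard_chain: "\<exists>x. alternating_chain Q H \<alpha> x"
    if "continuous_domain P" "decreasing_chain P \<alpha> x" "wadge_hard P Q H (diff_class \<alpha> P)"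
    for P :: "('p + nat set) rel" and x
    using wadge_hard_alternating_chain[OF continuous_domain_po[OF that(1)] Q that(2,3)] .
  have pow_chain: "\<exists>x. alternating_chain Q H \<alpha> x"
    if "wadge_hard pow_nat Q H (diff_class \<alpha> pow_nat)"
    using wadge_hard_alternating_chain[OF id(1) Q _ that] id(2) by blast
  have part1: "(let
      i = (\<forall>P :: ('p + nat set) rel. continuous_domain P \<longrightarrow> wadge_hard P Q H (diff_class \<alpha> P));
      ii = wadge_hard pow_nat Q H (diff_class \<alpha> pow_nat);
      iii = (\<exists>P :: ('p + nat set) rel. continuous_domain P \<and> (\<exists>x. decreasing_chain P \<alpha> x) \<and>
               wadge_hard P Q H (diff_class \<alpha> P));
      iv = (\<exists>x. alternating_chain Q H \<alpha> x)
    in (i \<longleftrightarrow> ii) \<and> (ii \<longleftrightarrow> iii) \<and> (iii \<longleftrightarrow> iv))"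
    (is "let i = ?i; ii = ?ii; iii = ?iii; iv = ?iv in _")
  proof -
    \<comment> \<open>Two cycles: from the fourth condition through the first and third and back,
      and through the second and back.\<close>
    have "?iv \<Longrightarrow> ?i" "?iv \<Longrightarrow> ?ii" using chain_hard by blast+
    moreover have "?i \<Longrightarrow> ?iii" using cp(1,2) by blast
    moreover have "?ii \<Longrightarrow> ?iv" by (rule pow_chain)
    moreover have "?iii \<Longrightarrow> ?iv" using hard_chain by blast
    ultimately show ?thesis unfolding Let_def by argo
  qed
  have part2: "let
      i\<^sub>e = (\<exists>R \<rho>. computable_copy R \<rho> {..\<alpha>} \<and>
              (\<forall>(P :: ('p + nat set) rel) p. effective_presentation P p \<longrightarrow>
                 wadge_hard P Q H (diff_class \<alpha> P) \<and>
                 eff_wadge_hard P p Q q H (eff_diff_class R \<rho> \<alpha> (basic_open P p))));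
      ii\<^sub>e = (\<exists>R \<rho>. computable_copy R \<rho> {..\<alpha>} \<and>
              eff_wadge_hard pow_nat set_decode Q q H
                (eff_diff_class R \<rho> \<alpha> (basic_open pow_nat set_decode)));
      iii\<^sub>e = (\<exists>R \<rho>. computable_copy R \<rho> {..\<alpha>} \<and>
              (\<exists>(P :: ('p + nat set) rel) p. effective_presentation P p \<and> algebraic_domain P \<and>
                 (\<exists>x. decreasing_chain P \<alpha> x \<and> computable_rel (chain_rel P p R \<rho> x)) \<and>
                 eff_wadge_hard P p Q q H (eff_diff_class R \<rho> \<alpha> (basic_open P p))));
      iv\<^sub>e = (\<exists>x. alternating_chain Q H \<alpha> x \<and> effective_seq Q q \<alpha> x)
    in (i\<^sub>e \<longleftrightarrow> ii\<^sub>e) \<and> (ii\<^sub>e \<longleftrightarrow> iii\<^sub>e) \<and> (iii\<^sub>e \<longleftrightarrow> iv\<^sub>e)"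
    (is "let i = ?i; ii = ?ii; iii = ?iii; iv = ?iv in _")
    if q: "presentation Q q" for q
  proof -
    \<comment> \<open>The copy of \<alpha> + 1 that codes the given chain also serves the classes in
      both hardness conditions; the converse directions keep the copy given with the
      hardness.\<close>
    have "?i \<and> ?ii" if iv: ?iv
    proof -
      obtain x R \<rho> where x: "alternating_chain Q H \<alpha> x" and R: "computable_copy R \<rho> {..\<alpha>}"
        and ce: "ce_rel (chain_rel Q q R \<rho> x)"
        using iv unfolding effective_seq_def by blast
      note hard = alternating_chain_eff_wadge_hard[OF q _ R x ce]
      have "eff_wadge_hard P p Q q H (eff_diff_class R \<rho> \<alpha> (basic_open P p))"
        if "effective_presentation P p" for P :: "('p + nat set) rel" and p
        using that by (intro hard) (simp add: effective_presentation_def)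
      moreover have "eff_wadge_hard pow_nat set_decode Q q H
          (eff_diff_class R \<rho> \<alpha> (basic_open pow_nat set_decode))"
        using id(3) by (intro hard) (simp add: effective_presentation_def)
      ultimately show ?thesis using R chain_hard[OF x] by blast
    qed
    \<comment> \<open>The \<open>Inr\<close> copy is algebraic and has a computable chain for
      whichever \<open>R\<close> is given.\<close>
    moreover have "?i \<Longrightarrow> ?iii" using cp(3-5) by blast
    moreover have ?iv if ii: ?ii
    proof -
      obtain R \<rho> where R: "computable_copy R \<rho> {..\<alpha>}" and hard: "eff_wadge_hard pow_nat set_decode Q q H
          (eff_diff_class R \<rho> \<alpha> (basic_open pow_nat set_decode))"
        using ii by blast
      obtain x where x: "decreasing_chain pow_nat \<alpha> x"
        "computable_rel (chain_rel pow_nat set_decode R \<rho> x)"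
        using id(4)[OF R] by blast
      have "presentation pow_nat set_decode" using id(3) by (simp add: effective_presentation_def)
      from eff_wadge_hard_alternating_chain[OF this Q R x hard] show ?thesis .
    qed
    moreover have ?iv if iii: ?iii
    proof -
      obtain R \<rho> and P :: "('p + nat set) rel" and p x where
        R: "computable_copy R \<rho> {..\<alpha>}" and P: "effective_presentation P p" and
        x: "decreasing_chain P \<alpha> x" "computable_rel (chain_rel P p R \<rho> x)" and
        hard: "eff_wadge_hard P p Q q H (eff_diff_class R \<rho> \<alpha> (basic_open P p))"
        using iii by blast
      have "presentation P p" using P by (simp add: effective_presentation_def)
      from eff_wadge_hard_alternating_chain[OF this Q R x hard] show ?thesis .
    qed
    ultimately show ?thesis unfolding Let_def by argo
  qed
  show ?thesis using part1 part2 by (intro conjI allI impI) (simp_all only:)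
qed

end
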